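(* Let $G$ be an infinite vertex-transitive graph of degree $d$, and let $\mu$ be a finite Borel measure with $\mathrm{supp}(\mu)\subseteq\mathrm{psp}(G)$. Then there exists an invariant random process $X$ with $\mathbb E X_o^2<\infty$ whose spectral measure is $\mu_X=\mu$.
   Context: An invariant random process is a family $(X_v)_{v\in V(G)}$ of real random variables whose joint law is $\mathrm{Aut}(G)$-invariant. With $A$ the adjacency operator, $\delta_v$ the indicator of $v$, $o$ a root, and $(A^kX)_v=\sum_w(A^k\delta_v)(w)X_w$ (sum of $X$ over endpoints of all length-$k$ walks from $v$), the spectral measure $\mu_X$ of an invariant process with $\mathbb E X_o^2<\infty$ is the unique finite Borel measure on $[-d,d]$ with $\mathbb E[(A^kX)_oX_o]=\int t^kd\mu_X(t)$ for all $k\ge0$. The process spectrum is $\mathrm{psp}(G)=\overline{\bigcup_X\mathrm{supp}(\mu_X)}\subseteq[-d,d]$, the union being over all invariant random processes $X$ on $G$ whose marginals have finite variance. *)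

theory Defs
  imports "HOL-Probability.Probability"
begin

definition graph_automorphism :: "('v \<Rightarrow> 'v \<Rightarrow> bool) \<Rightarrow> ('v \<Rightarrow> 'v) \<Rightarrow> bool" where
  "graph_automorphism E \<gamma> \<longleftrightarrow> bij \<gamma> \<and> (\<forall>u v. E u v \<longleftrightarrow> E (\<gamma> u) (\<gamma> v))"

definition vertex_transitive :: "('v \<Rightarrow> 'v \<Rightarrow> bool) \<Rightarrow> bool" where
  "vertex_transitive E \<longleftrightarrow> (\<forall>u v. \<exists>\<gamma>. graph_automorphism E \<gamma> \<and> \<gamma> u = v)"

definition regular_graph :: "('v \<Rightarrow> 'v \<Rightarrow> bool) \<Rightarrow> nat \<Rightarrow> bool" where
  "regular_graph E d \<longleftrightarrow> (\<forall>u v. E u v \<longleftrightarrow> E v u) \<and> (\<forall>v. \<not> E v v)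
     \<and> (\<forall>v. finite {w. E v w} \<and> card {w. E v w} = d)"

primrec adj_pow :: "('v \<Rightarrow> 'v \<Rightarrow> bool) \<Rightarrow> nat \<Rightarrow> ('v \<Rightarrow> real) \<Rightarrow> 'v \<Rightarrow> real" where
  "adj_pow E 0 f = f"
| "adj_pow E (Suc k) f = (\<lambda>v. \<Sum>w\<in>{w. E v w}. adj_pow E k f w)"

text \<open>An invariant random process is represented by its joint law: a probability
measure on the product space of real configurations indexed by the vertices,
invariant under every graph automorphism. The process is the family of
coordinate projections X_v(x) = x v.\<close>

abbreviation config_space :: "('v \<Rightarrow> real) measure" where
  "config_space \<equiv> PiM UNIV (\<lambda>_. borel)"

definition invariant_process :: "('v \<Rightarrow> 'v \<Rightarrow> bool) \<Rightarrow> ('v \<Rightarrow> real) measure \<Rightarrow> bool" where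
  "invariant_process E P \<longleftrightarrow> prob_space P \<and> sets P = sets config_space
     \<and> (\<forall>\<gamma>. graph_automorphism E \<gamma> \<longrightarrow> distr P config_space (\<lambda>x. x \<circ> \<gamma>) = P)"

definition spectral_measure_of ::
  "('v \<Rightarrow> 'v \<Rightarrow> bool) \<Rightarrow> nat \<Rightarrow> 'v \<Rightarrow> ('v \<Rightarrow> real) measure \<Rightarrow> real measure \<Rightarrow> bool" where
  "spectral_measure_of E d \<rho> P \<mu> \<longleftrightarrow>
     sets \<mu> = sets borel \<and> finite_measure \<mu> \<and> emeasure \<mu> (- {- real d .. real d}) = 0
     \<and> (\<forall>k. integrable P (\<lambda>x. adj_pow E k x \<rho> * x \<rho>)
          \<and> integrable \<mu> (\<lambda>t. t ^ k)
          \<and> (\<integral>x. adj_pow E k x \<rho> * x \<rho> \<partial>P) = (\<integral>t. t ^ k \<partial>\<mu>))"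

definition measure_support :: "real measure \<Rightarrow> real set" where
  "measure_support \<mu> = {t. \<forall>e>0. emeasure \<mu> (ball t e) > 0}"

definition process_spectrum :: "('v \<Rightarrow> 'v \<Rightarrow> bool) \<Rightarrow> nat \<Rightarrow> 'v \<Rightarrow> real set" where
  "process_spectrum E d \<rho> = closure (\<Union> {measure_support \<mu> | P \<mu>.
      invariant_process E P \<and> integrable P (\<lambda>x. (x \<rho>)\<^sup>2) \<and> spectral_measure_of E d \<rho> P \<mu>})"

end

theory Submission
  imports Defs
begin

text \<open>
  A symmetric positive semidefinite kernel \<open>c\<close> that is invariant under the automorphisms is the
  covariance of an invariant (Gaussian) process, and the moments \<open>(A\<^sup>k c)(\<rho>, \<rho>)\<close> depend on \<open>c\<close> only.
  So it suffices to find an invariant kernel with the moments of \<open>\<mu>\<close>. Invariant kernels with bounded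
  diagonal form a compact convex set; hence if no kernel has the right first \<open>N\<close> moments, a
  polynomial \<open>p\<close> separates: \<open>(p(A) c)(\<rho>, \<rho>) \<ge> 0\<close> for all invariant kernels, but \<open>\<integral> p d\<mu> < 0\<close>, so
  that \<open>p\<close> is negative somewhere on the process spectrum. This is impossible: \<open>p(A)\<close> is accretive on
  every process \<open>X\<close>, so the powers of \<open>1 - \<epsilon> p(A)\<close> grow at rate \<open>1 + O(\<epsilon>\<^sup>2)\<close> only, whereas
  \<open>\<integral> (1 - \<epsilon> p)\<^sup>n d\<mu>\<^sub>X\<close> would grow at rate \<open>1 + \<epsilon>\<eta>\<close> for some \<open>\<eta> > 0\<close>. The argument does not need \<open>A\<close> to
  be self-adjoint on processes, which fails when the graph is not unimodular.
\<close>

subsection \<open>Characteristic functions on product spaces\<close>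

text \<open>The value of \<open>char\<close> at 0 is the total mass, so both measures have the same
  mass \<open>m\<close>. For \<open>m > 0\<close>, division by \<open>m\<close> reduces the claim to
  Levy uniqueness for probability measures; for \<open>m = 0\<close> both measures vanish.\<close>

lemma finite_measure_eqI_char:
  fixes M N :: "real measure"
  assumes "finite_measure M" "finite_measure N"
    and sM: "sets M = sets borel" and sN: "sets N = sets borel"
    and char: "\<And>t. char M t = char N t"
  shows "M = N"
proof -
  interpret M: finite_measure M by fact
  interpret N: finite_measure N by fact
  have sp: "space M = UNIV" "space N = UNIV"
    using sets_eq_imp_space_eq[OF sM] sets_eq_imp_space_eq[OF sN] by auto
  define m where "m = measure M UNIV"
  have mN: "measure N UNIV = m"
    using char[of 0] by (simp add: char_def m_def sp scaleR_conv_of_real)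
  have eM: "emeasure M UNIV = ennreal m" and eN: "emeasure N UNIV = ennreal m"
    by (simp_all add: M.emeasure_eq_measure N.emeasure_eq_measure mN m_def)
  show ?thesis
  proof (cases "m = 0")
    case True
    have "emeasure M A = 0" "emeasure N A = 0" for A
      using emeasure_mono[of A UNIV M] emeasure_mono[of A UNIV N] eM eN True
        sets.top[of M] sets.top[of N] sp by auto
    then show ?thesis
      by (intro measure_eqI) (auto simp: sM sN)
  next
    case False
    then have m: "m > 0" by (simp add: m_def zero_less_measure_iff)
    have [measurable_cong]: "sets M = sets borel" "sets N = sets borel" by fact+
    let ?D = "\<lambda>K. density K (\<lambda>_::real. ennreal (1/m))"
    have dist: "real_distribution (?D K)"
      if "sets K = sets borel" "space K = UNIV" "emeasure K UNIV = ennreal m" for K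
    proof -
      have "prob_space (?D K)"
        using that m by (intro prob_spaceI) (auto simp: emeasure_density simp flip: ennreal_mult)
      then show ?thesis
        using that by (auto simp: real_distribution_def real_distribution_axioms_def)
    qed
    have ch: "char (?D K) t = char K t / m" if "sets K = sets borel" for K t
    proof -
      have [measurable_cong]: "sets K = sets borel" by fact
      show ?thesis
        unfolding char_def using m
        by (subst integral_density) (auto simp: scaleR_conv_of_real field_simps)
    qed
    have eq: "?D M = ?D N"
      by (rule Levy_uniqueness) (auto simp: dist sM sN sp eM eN ch char fun_eq_iff)
    have unscale: "emeasure K A = ennreal m * emeasure (?D K) A"
      if "sets K = sets borel" "A \<in> sets borel" for K A
      using that m by (simp add: emeasure_density nn_integral_cmult mult.assoc[symmetric] flip: ennreal_mult)
    show ?thesis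
      by (intro measure_eqI) (simp_all add: unscale[OF sM] unscale[OF sN] sM sN eq)
  qed
qed

text \<open>A weight that changes sign is not a density, but \<open>1 + u\<close> takes values in
  [0,2]. So \<open>1 + u\<close> and the constant 1 both serve as densities; uniqueness applies to
  their images under \<open>X\<close>, and the claim for \<open>u\<close> is the difference of the
  two results.\<close>

lemma integral_weight_indicator_eqI:
  fixes u X :: "'a \<Rightarrow> real"
  assumes "finite_measure P" "finite_measure Q" and PQ: "sets P = sets Q"
    and X: "X \<in> borel_measurable P" and u: "u \<in> borel_measurable P" and bd: "\<And>x. \<bar>u x\<bar> \<le> 1"
    and one: "\<And>s. (CLINT x|P. iexp (s * X x)) = (CLINT x|Q. iexp (s * X x))"
    and wt: "\<And>s. (CLINT x|P. u x * iexp (s * X x)) = (CLINT x|Q. u x * iexp (s * X x))"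
    and B: "B \<in> sets borel"
  shows "(LINT x|P. u x * indicator B (X x)) = (LINT x|Q. u x * indicator B (X x))"
proof -
  let ?N = "\<lambda>K h. distr (density K (\<lambda>x. ennreal (h x))) borel X"
  have *: "measure (?N P h) B = measure (?N Q h) B \<and> measure (?N K h) B = (LINT x|K. h x * indicator B (X x))"
    if h: "h \<in> borel_measurable P" "\<And>x. 0 \<le> h x" "\<And>x. h x \<le> 2" and K: "K = P \<or> K = Q"
      and eq: "\<And>s. (CLINT x|P. h x * iexp (s * X x)) = (CLINT x|Q. h x * iexp (s * X x))" for h K
  proof -
    have [measurable]: "X \<in> borel_measurable K" "h \<in> borel_measurable K" "finite_measure K"
      if "K = P \<or> K = Q" for K
      using that X h PQ assms(1,2) by (auto simp: measurable_cong_sets[OF PQ refl])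
    have int: "integrable K h" if "K = P \<or> K = Q" for K
      using that h(2,3) assms(1,2) by (intro finite_measure.integrable_const_bound[where B=2]) auto
    have fin: "finite_measure (?N K h)" if K: "K = P \<or> K = Q" for K
    proof -
      have "emeasure (density K (\<lambda>x. ennreal (h x))) (space K) = ennreal (integral\<^sup>L K h)"
        using K h(2) int[OF K] by (simp add: emeasure_density nn_integral_eq_integral cong: nn_integral_cong)
      then have "finite_measure (density K (\<lambda>x. ennreal (h x)))"
        by (intro finite_measureI) simp
      then show ?thesis
        using K by (intro finite_measure.finite_measure_distr) auto
    qed
    have ch: "char (?N K h) s = (CLINT x|K. h x * iexp (s * X x))" if K: "K = P \<or> K = Q" for K s
      unfolding char_def using K h(2)
      by (simp add: integral_distr integral_density scaleR_conv_of_real)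
    have "?N P h = ?N Q h"
      by (rule finite_measure_eqI_char) (auto simp: fin ch eq simp del: of_real_mult)
    moreover have "measure (?N K h) B = (LINT x|K. h x * indicator B (X x))"
    proof -
      have "measure (?N K h) B = (LINT y|?N K h. indicator B y)"
        using B by simp
      also have "\<dots> = (LINT x|K. h x * indicator B (X x))"
        using K h(2) B by (subst integral_distr) (auto simp: integral_density)
      finally show ?thesis .
    qed
    ultimately show ?thesis by simp
  qed
  have mK: "X \<in> borel_measurable K" "u \<in> borel_measurable K" "finite_measure K"
    if "K = P \<or> K = Q" for K
    using that X u PQ assms(1,2) by (auto simp: measurable_cong_sets[OF PQ refl])
  note [measurable] = mK(1,2) B
  have int_u: "integrable K (\<lambda>x. u x * indicator B (X x))"
     and int_1: "integrable K (\<lambda>x. indicator B (X x) :: real)"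
     and int_ui: "integrable K (\<lambda>x. u x * iexp (s * X x))"
     and int_i: "integrable K (\<lambda>x. iexp (s * X x))"
    if K: "K = P \<or> K = Q" for K s
    using K bd mK(3)[OF K]
    by (auto intro!: finite_measure.integrable_const_bound[where B=1] split: split_indicator
        simp: norm_mult abs_mult)
  have "(LINT x|P. indicator B (X x) :: real) = (LINT x|Q. indicator B (X x))"
    using *[of "\<lambda>_. 1" P] *[of "\<lambda>_. 1" Q] one by simp
  moreover have "(LINT x|P. (1 + u x) * indicator B (X x)) = (LINT x|Q. (1 + u x) * indicator B (X x))"
  proof -
    have eq: "(CLINT x|P. complex_of_real (1 + u x) * iexp (s * X x)) =
      (CLINT x|Q. complex_of_real (1 + u x) * iexp (s * X x))" for s
      using one[of s] wt[of s] int_ui[of P s] int_i[of P s] int_ui[of Q s] int_i[of Q s]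
      by (simp add: distrib_right del: of_real_mult)
    have b: "0 \<le> 1 + u x" "1 + u x \<le> 2" for x using bd[of x] by auto
    show ?thesis
      using *[of "\<lambda>x. 1 + u x" P] *[of "\<lambda>x. 1 + u x" Q] eq b u by auto
  qed
  ultimately show ?thesis
    using int_u[of P] int_1[of P] int_u[of Q] int_1[of Q] by (simp add: distrib_right)
qed

text \<open>Reduction to real weights: the transform of \<open>Re w\<close> at \<open>s\<close> is
  the mean of the transform of \<open>w\<close> at \<open>s\<close> and the conjugate of its
  transform at \<open>-s\<close>. The imaginary part is the real part of
  \<open>- \<i> * w\<close>.\<close>

lemma integral_complex_weight_indicator_eqI:
  fixes w :: "'a \<Rightarrow> complex" and X :: "'a \<Rightarrow> real"
  assumes "finite_measure P" "finite_measure Q" and PQ: "sets P = sets Q"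
    and X: "X \<in> borel_measurable P" and w: "w \<in> borel_measurable P" and bd: "\<And>x. norm (w x) \<le> 1"
    and one: "\<And>s. (CLINT x|P. iexp (s * X x)) = (CLINT x|Q. iexp (s * X x))"
    and wt: "\<And>s. (CLINT x|P. w x * iexp (s * X x)) = (CLINT x|Q. w x * iexp (s * X x))"
    and B: "B \<in> sets borel"
  shows "(CLINT x|P. w x * indicator B (X x)) = (CLINT x|Q. w x * indicator B (X x))"
proof -
  have Re_eq: "(LINT x|P. Re (w x) * indicator B (X x)) = (LINT x|Q. Re (w x) * indicator B (X x))"
    if w: "w \<in> borel_measurable P" and bd: "\<And>x. norm (w x) \<le> 1"
      and wt: "\<And>s. (CLINT x|P. w x * iexp (s * X x)) = (CLINT x|Q. w x * iexp (s * X x))"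
    for w :: "'a \<Rightarrow> complex"
  proof (rule integral_weight_indicator_eqI[OF assms(1,2) PQ X _ _ one _ B])
    show "(\<lambda>x. Re (w x)) \<in> borel_measurable P" using w by simp
    show "\<bar>Re (w x)\<bar> \<le> 1" for x using abs_Re_le_cmod[of "w x"] bd[of x] by linarith
    fix s
    have Re_w: "(CLINT x|K. Re (w x) * iexp (s * X x)) =
       ((CLINT x|K. w x * iexp (s * X x)) + cnj (CLINT x|K. w x * iexp (- s * X x))) / 2"
      if K: "K = P \<or> K = Q" for K
    proof -
      have [measurable]: "X \<in> borel_measurable K" "w \<in> borel_measurable K"
        using K X w PQ by (auto simp: measurable_cong_sets[OF PQ refl])
      have fK: "finite_measure K" using K assms(1,2) by auto
      have int: "integrable K (\<lambda>x. w x * iexp (r * X x))" for r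
        using bd by (intro finite_measure.integrable_const_bound[OF fK, where B=1]) (auto simp: norm_mult)
      have "Re (w x) * iexp (s * X x) = (w x * iexp (s * X x) + cnj (w x * iexp (- s * X x))) / 2" for x
        by (simp add: exp_cnj complex_eq_iff)
      then have "(CLINT x|K. Re (w x) * iexp (s * X x)) =
         (CLINT x|K. (w x * iexp (s * X x) + cnj (w x * iexp (- s * X x))) / 2)"
        by (simp only:)
      also have "\<dots> = ((CLINT x|K. w x * iexp (s * X x)) + (CLINT x|K. cnj (w x * iexp (- s * X x)))) / 2"
        by (subst integral_divide_zero, subst Bochner_Integration.integral_add)
          (use int[of s] int[of "-s"] in \<open>simp_all only: integrable_cnj\<close>)
      finally show ?thesis by (simp only: Bochner_Integration.integral_cnj)
    qed
    show "(CLINT x|P. Re (w x) * iexp (s * X x)) = (CLINT x|Q. Re (w x) * iexp (s * X x))"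
      by (simp only: Re_w[of P] Re_w[of Q] wt simp_thms)
  qed
  have Im_eq: "(LINT x|P. Im (w x) * indicator B (X x)) = (LINT x|Q. Im (w x) * indicator B (X x))"
    using Re_eq[of "\<lambda>x. - \<i> * w x"] w bd wt by (simp add: norm_mult mult.assoc)
  have int: "integrable K (\<lambda>x. w x * indicator B (X x))" if K: "K = P \<or> K = Q" for K
  proof -
    have [measurable]: "X \<in> borel_measurable K" "w \<in> borel_measurable K" "B \<in> sets borel"
      using K X w PQ B by (auto simp: measurable_cong_sets[OF PQ refl])
    have fK: "finite_measure K" using K assms(1,2) by auto
    show ?thesis
      using bd by (intro finite_measure.integrable_const_bound[OF fK, where B=1])
        (auto simp: norm_mult split: split_indicator)
  qed
  have *: "Re (w x * indicator B (X x)) = Re (w x) * indicator B (X x)"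
    "Im (w x * indicator B (X x)) = Im (w x) * indicator B (X x)" for x
    by (auto split: split_indicator)
  have "Re (CLINT x|K. w x * indicator B (X x)) = (LINT x|K. Re (w x) * indicator B (X x))"
    "Im (CLINT x|K. w x * indicator B (X x)) = (LINT x|K. Im (w x) * indicator B (X x))"
    if "K = P \<or> K = Q" for K
    using int[OF that] by (simp_all only: integral_Re[symmetric] integral_Im[symmetric] *)
  then show ?thesis
    using Re_eq[OF w bd wt] Im_eq by (simp add: complex_eq_iff)
qed

text \<open>The characters are traded for indicators one coordinate at a time, so that only the
  one-dimensional uniqueness theorem is needed.\<close>

lemma PiM_eqI_char:
  fixes P Q :: "('i \<Rightarrow> real) measure"
  assumes "prob_space P" "prob_space Q"
    and sP: "sets P = sets (PiM I (\<lambda>_. borel))" and sQ: "sets Q = sets (PiM I (\<lambda>_. borel))"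
    and char: "\<And>J t. finite J \<Longrightarrow> J \<subseteq> I \<Longrightarrow>
      (CLINT x|P. iexp (\<Sum>v\<in>J. t v * x v)) = (CLINT x|Q. iexp (\<Sum>v\<in>J. t v * x v))"
  shows "P = Q"
proof (rule measure_eqI_PiM_infinite[OF sP sQ])
  interpret P: prob_space P by fact
  interpret Q: prob_space Q by fact
  show "finite_measure P" by unfold_locales
  have [measurable_cong]: "sets P = sets (PiM I (\<lambda>_. borel))" "sets Q = sets (PiM I (\<lambda>_. borel))" by fact+
  fix A J assume J: "finite J" "J \<subseteq> I" and A: "\<And>i. i \<in> J \<Longrightarrow> A i \<in> sets (borel :: real measure)"
  \<comment> \<open>\<open>J'\<close> collects the coordinates that already carry an indicator. The
    induction keeps \<open>t\<close> arbitrary, because the step for a new coordinate uses the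
    hypothesis at altered frequencies.\<close>
  have ind: "(CLINT x|P. (\<Prod>v\<in>J'. indicator (A v) (x v)) * iexp (\<Sum>v\<in>J. t v * x v)) =
     (CLINT x|Q. (\<Prod>v\<in>J'. indicator (A v) (x v)) * iexp (\<Sum>v\<in>J. t v * x v))"
    if "J' \<subseteq> J" for J' t
    using finite_subset[OF that J(1)] that
  proof (induction J' arbitrary: t rule: finite_induct)
    case empty
    then show ?case using char[OF J] by simp
  next
    case (insert j J')
    have j: "j \<in> J" "j \<in> I" and J': "J' \<subseteq> J" using insert J by auto
    have mJ: "v \<in> I" if "v \<in> J" for v using that J by auto
    let ?w = "\<lambda>x. (\<Prod>v\<in>J'. indicator (A v) (x v)) * iexp (\<Sum>v\<in>J. t v * x v)"
    \<comment> \<open>An extra factor \<open>iexp (s * x j)\<close> only moves the frequency at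
      \<open>j\<close> from \<open>t j\<close> to \<open>t j + s\<close>, so the product stays in
      the family covered by the induction hypothesis.\<close>
    have shift: "(\<Sum>v\<in>J. (t v + (if v = j then s else 0)) * x v) = (\<Sum>v\<in>J. t v * x v) + s * x j" 
      for s t and x :: "'i \<Rightarrow> real"
    proof -
      have "(\<Sum>v\<in>J. (if v = j then s else 0) * x v) = s * x j"
        using J(1) j(1) by (subst sum.remove[of _ j]) auto
      then show ?thesis by (simp add: distrib_right sum.distrib)
    qed
    have "(CLINT x|P. ?w x * indicator (A j) (x j)) = (CLINT x|Q. ?w x * indicator (A j) (x j))"
    proof (rule integral_complex_weight_indicator_eqI)
      show "finite_measure P" "finite_measure Q" by unfold_locales
      show "sets P = sets Q" using sP sQ by simp
      show "(\<lambda>x. x j) \<in> borel_measurable P" using j by measurable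
      have ms: "(\<lambda>x. x v) \<in> borel_measurable P" if "v \<in> J" for v
        using mJ[OF that] by measurable
      have mi: "(\<lambda>x. indicator (A v) (x v) :: complex) \<in> borel_measurable P" if "v \<in> J'" for v
        using ms[of v] A[of v] J' that by (auto intro!: measurable_compose[OF ms])
      show "?w \<in> borel_measurable P"
        using ms by (intro borel_measurable_times borel_measurable_prod mi) (auto intro!: borel_measurable_sum)
      show "norm (?w x) \<le> 1" for x
        by (auto simp: norm_mult prod_norm[symmetric] simp del: of_real_sum intro!: prod_le_1 split: split_indicator)
      show "A j \<in> sets borel" using A j by auto
      fix s
      show "(CLINT x|P. iexp (s * x j)) = (CLINT x|Q. iexp (s * x j))"
        using char[OF J, of "\<lambda>v. 0 + (if v = j then s else 0)"] unfolding shift by simp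
      have e: "?w x * iexp (s * x j) = (\<Prod>v\<in>J'. indicator (A v) (x v)) *
         iexp (\<Sum>v\<in>J. (t v + (if v = j then s else 0)) * x v)" for x
        unfolding shift by (simp add: exp_add distrib_left mult.assoc)
      show "(CLINT x|P. ?w x * iexp (s * x j)) = (CLINT x|Q. ?w x * iexp (s * x j))"
        unfolding e by (rule insert.IH[OF J'])
    qed
    then show ?case
      using insert.hyps by (simp add: mult_ac)
  qed
  \<comment> \<open>With all coordinates of \<open>J\<close> traded and \<open>t = 0\<close>, the
    integral is the probability of the cylinder.\<close>
  have "emeasure K (prod_emb I (\<lambda>_. borel) J (Pi\<^sub>E J A)) = ennreal (Re (CLINT x|K. (\<Prod>v\<in>J. indicator (A v) (x v))))"
    if K: "prob_space K" "sets K = sets (PiM I (\<lambda>_. borel))" for K :: "('i \<Rightarrow> real) measure"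
  proof -
    interpret K: prob_space K by fact
    let ?E = "prod_emb I (\<lambda>_. borel :: real measure) J (Pi\<^sub>E J A)"
    have E: "?E \<in> sets K"
      unfolding K(2) using J A by (intro sets_PiM_I) auto
    have "(CLINT x|K. (\<Prod>v\<in>J. indicator (A v) (x v))) = (CLINT x|K. of_real (indicator ?E x))"
    proof (intro Bochner_Integration.integral_cong refl)
      fix x assume "x \<in> space K"
      then have "x \<in> extensional I" using sets_eq_imp_space_eq[OF K(2)] by (auto simp: space_PiM PiE_def)
      then have "x \<in> ?E \<longleftrightarrow> (\<forall>v\<in>J. x v \<in> A v)"
        using J by (auto simp: prod_emb_iff PiE_def Pi_iff)
      moreover have "(\<Prod>v\<in>J. indicator (A v) (x v)) = (if \<forall>v\<in>J. x v \<in> A v then 1 else 0 :: complex)"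
        using J(1) by (auto simp: indicator_def)
      ultimately show "(\<Prod>v\<in>J. indicator (A v) (x v)) = complex_of_real (indicator ?E x)"
        by (auto simp: indicator_def)
    qed
    also have "\<dots> = measure K ?E"
      using E by (simp add: scaleR_conv_of_real integral_complex_of_real)
    finally show ?thesis by (simp add: K.emeasure_eq_measure)
  qed
  from this[OF assms(1) sP] this[OF assms(2) sQ] ind[OF subset_refl, of "\<lambda>_. 0"]
  show "emeasure P (prod_emb I (\<lambda>_. borel) J (Pi\<^sub>E J A)) = emeasure Q (prod_emb I (\<lambda>_. borel) J (Pi\<^sub>E J A))"
    by simp
qed

subsection \<open>Finitely supported functionals\<close>

text \<open>A functional rather than a coefficient vector: evaluations, polynomials in the adjacency
  operator read at a vertex, and their compositions are then objects of one kind, and a bilinear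
  form is two nested applications.\<close>

definition finite_functional :: "(('v \<Rightarrow> real) \<Rightarrow> real) \<Rightarrow> bool" where
  "finite_functional \<phi> \<longleftrightarrow> (\<exists>J a. finite J \<and> \<phi> = (\<lambda>f. \<Sum>v\<in>J. a v * f v))"

lemma finite_functionalI: "finite J \<Longrightarrow> finite_functional (\<lambda>f. \<Sum>v\<in>J. a v * f v)"
  by (auto simp: finite_functional_def)

lemma finite_functionalE:
  assumes "finite_functional \<phi>"
  obtains J a where "finite J" "\<And>f. \<phi> f = (\<Sum>v\<in>J. a v * f v)"
  using assms by (auto simp: finite_functional_def)

lemma finite_functional_eval: "finite_functional (\<lambda>f. f v)"
  using finite_functionalI[of "{v}" "\<lambda>_. 1"] by simp

lemma finite_functional_scale:
  assumes "finite_functional \<phi>"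
  shows "finite_functional (\<lambda>f. r * \<phi> f)"
proof -
  obtain J a where "finite J" "\<And>f. \<phi> f = (\<Sum>v\<in>J. a v * f v)"
    using assms by (rule finite_functionalE) blast
  then show ?thesis
    using finite_functionalI[of J "\<lambda>v. r * a v"] by (simp add: sum_distrib_left mult.assoc)
qed

lemma finite_functional_add:
  assumes "finite_functional \<phi>" "finite_functional \<psi>"
  shows "finite_functional (\<lambda>f. \<phi> f + \<psi> f)"
proof -
  obtain J a where J: "finite J" "\<And>f. \<phi> f = (\<Sum>v\<in>J. a v * f v)"
    using assms(1) by (rule finite_functionalE) blast
  obtain K b where K: "finite K" "\<And>f. \<psi> f = (\<Sum>v\<in>K. b v * f v)"
    using assms(2) by (rule finite_functionalE) blast
  have "\<phi> f + \<psi> f = (\<Sum>v\<in>J\<union>K. ((if v \<in> J then a v else 0) + (if v \<in> K then b v else 0)) * f v)" for f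
  proof -
    have "\<phi> f = (\<Sum>v\<in>J\<union>K. (if v \<in> J then a v else 0) * f v)"
      unfolding J(2) using J(1) K(1) by (intro sum.mono_neutral_cong_left) auto
    moreover have "\<psi> f = (\<Sum>v\<in>J\<union>K. (if v \<in> K then b v else 0) * f v)"
      unfolding K(2) using J(1) K(1) by (intro sum.mono_neutral_cong_left) auto
    ultimately show ?thesis by (simp add: distrib_right sum.distrib)
  qed
  then show ?thesis
    using finite_functionalI[of "J \<union> K"] J(1) K(1) by simp
qed

lemma finite_functional_sum:
  assumes "\<And>i. i \<in> I \<Longrightarrow> finite_functional (\<phi> i)"
  shows "finite_functional (\<lambda>f. \<Sum>i\<in>I. \<phi> i f)"
  using assms
proof (induction I rule: infinite_finite_induct)
  case (insert i I)
  then show ?case by (simp add: finite_functional_add)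
qed (use finite_functionalI[of "{}"] in auto)

lemma finite_functional_linear:
  assumes "finite_functional \<phi>"
  shows finite_functional_of_add: "\<phi> (\<lambda>v. f v + g v) = \<phi> f + \<phi> g"
    and finite_functional_of_scale: "\<phi> (\<lambda>v. r * f v) = r * \<phi> f"
    and finite_functional_of_sum: "\<phi> (\<lambda>v. \<Sum>i\<in>I. h i v) = (\<Sum>i\<in>I. \<phi> (h i))"
proof -
  obtain J a where J: "finite J" "\<And>f. \<phi> f = (\<Sum>v\<in>J. a v * f v)"
    using assms by (rule finite_functionalE) blast
  show "\<phi> (\<lambda>v. f v + g v) = \<phi> f + \<phi> g" "\<phi> (\<lambda>v. r * f v) = r * \<phi> f"
    by (simp_all add: J(2) distrib_left sum.distrib sum_distrib_left mult_ac)
  show "\<phi> (\<lambda>v. \<Sum>i\<in>I. h i v) = (\<Sum>i\<in>I. \<phi> (h i))"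
    by (simp add: J(2) sum_distrib_left sum.swap[of _ J])
qed

lemma finite_functional_swap:
  assumes "finite_functional \<phi>" "finite_functional \<psi>"
  shows "\<phi> (\<lambda>v. \<psi> (\<lambda>w. c v w)) = \<psi> (\<lambda>w. \<phi> (\<lambda>v. c v w))"
proof -
  obtain J a where J: "finite J" "\<And>f. \<phi> f = (\<Sum>v\<in>J. a v * f v)"
    using assms(1) by (rule finite_functionalE) blast
  show ?thesis
    unfolding J(2) finite_functional_of_sum[OF assms(2)] finite_functional_of_scale[OF assms(2)] ..
qed

lemma finite_functional_compose:
  assumes "finite_functional \<phi>" "\<And>v. finite_functional (\<lambda>f. L f v)"
  shows "finite_functional (\<lambda>f. \<phi> (\<lambda>v. L f v))"
proof -
  obtain J a where J: "finite J" "\<And>f. \<phi> f = (\<Sum>v\<in>J. a v * f v)"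
    using assms(1) by (rule finite_functionalE) blast
  show ?thesis
    unfolding J(2) by (intro finite_functional_sum finite_functional_scale assms(2))
qed

lemma finite_functional_integral:
  assumes "finite_functional \<phi>" "\<And>v. integrable M (h v)"
  shows "integrable M (\<lambda>x. \<phi> (\<lambda>v. h v x))"
    and "(LINT x|M. \<phi> (\<lambda>v. h v x)) = \<phi> (\<lambda>v. LINT x|M. h v x)"
proof -
  obtain J a where J: "finite J" "\<And>f. \<phi> f = (\<Sum>v\<in>J. a v * f v)"
    using assms(1) by (rule finite_functionalE) blast
  show "integrable M (\<lambda>x. \<phi> (\<lambda>v. h v x))"
    "(LINT x|M. \<phi> (\<lambda>v. h v x)) = \<phi> (\<lambda>v. LINT x|M. h v x)"
    unfolding J(2) using assms(2) by (simp_all add: Bochner_Integration.integral_sum)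
qed

lemma finite_functional_continuous:
  assumes "finite_functional \<phi>" "\<And>v. continuous_on S (\<lambda>c. h c v)"
  shows "continuous_on S (\<lambda>c. \<phi> (h c))"
proof -
  obtain J a where J: "finite J" "\<And>f. \<phi> f = (\<Sum>v\<in>J. a v * f v)"
    using assms(1) by (rule finite_functionalE) blast
  show ?thesis
    unfolding J(2) by (intro continuous_intros assms(2))
qed

subsection \<open>Positive semidefinite kernels\<close>

definition psd_kernel :: "('v \<Rightarrow> 'v \<Rightarrow> real) \<Rightarrow> bool" where
  "psd_kernel c \<longleftrightarrow> (\<forall>v w. c v w = c w v) \<and>
     (\<forall>\<phi>. finite_functional \<phi> \<longrightarrow> 0 \<le> \<phi> (\<lambda>v. \<phi> (\<lambda>w. c v w)))"

lemma psd_kernel_sym: "psd_kernel c \<Longrightarrow> c v w = c w v"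
  unfolding psd_kernel_def by blast

lemma psd_kernel_nonneg: "psd_kernel c \<Longrightarrow> finite_functional \<phi> \<Longrightarrow> 0 \<le> \<phi> (\<lambda>v. \<phi> (\<lambda>w. c v w))"
  unfolding psd_kernel_def by blast

text \<open>Serves twice: with \<open>r\<close> free it gives the quadratic behind Cauchy-Schwarz;
  with \<open>\<phi>\<close> an evaluation, \<open>\<psi>\<close> a polynomial in the adjacency
  operator and \<open>r = - \<epsilon>\<close> it gives the variance after applying
  \<open>1 - \<epsilon> p(A)\<close>.\<close>

lemma psd_kernel_expand:
  assumes c: "psd_kernel c" and \<phi>: "finite_functional \<phi>" and \<psi>: "finite_functional \<psi>"
  shows "(\<lambda>f. \<phi> f + r * \<psi> f) (\<lambda>v. (\<lambda>f. \<phi> f + r * \<psi> f) (\<lambda>w. c v w)) =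
    \<phi> (\<lambda>v. \<phi> (\<lambda>w. c v w)) + 2 * r * \<phi> (\<lambda>v. \<psi> (\<lambda>w. c v w)) + r\<^sup>2 * \<psi> (\<lambda>v. \<psi> (\<lambda>w. c v w))"
proof -
  have "\<psi> (\<lambda>v. \<phi> (\<lambda>w. c v w)) = \<phi> (\<lambda>v. \<psi> (\<lambda>w. c v w))"
    by (subst finite_functional_swap[OF \<psi> \<phi>]) (simp add: psd_kernel_sym[OF c])
  then show ?thesis
    by (simp add: finite_functional_linear[OF \<phi>] finite_functional_linear[OF \<psi>] algebra_simps power2_eq_square)
qed

lemma psd_kernel_Cauchy_Schwarz:
  assumes c: "psd_kernel c" and \<phi>: "finite_functional \<phi>" and \<psi>: "finite_functional \<psi>"
  shows "(\<phi> (\<lambda>v. \<psi> (\<lambda>w. c v w)))\<^sup>2 \<le> \<phi> (\<lambda>v. \<phi> (\<lambda>w. c v w)) * \<psi> (\<lambda>v. \<psi> (\<lambda>w. c v w))"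
proof -
  define A where "A = \<phi> (\<lambda>v. \<phi> (\<lambda>w. c v w))"
  define B where "B = \<phi> (\<lambda>v. \<psi> (\<lambda>w. c v w))"
  define C where "C = \<psi> (\<lambda>v. \<psi> (\<lambda>w. c v w))"
  have q: "0 \<le> A + 2 * r * B + r\<^sup>2 * C" for r
    using psd_kernel_nonneg[OF c finite_functional_add[OF \<phi> finite_functional_scale[OF \<psi>]], of r]
    unfolding psd_kernel_expand[OF c \<phi> \<psi>] A_def B_def C_def .
  have "B\<^sup>2 \<le> A * C"
  proof (cases "C = 0")
    case True
    have "B = 0"
    proof (rule ccontr)
      assume "B \<noteq> 0"
      \<comment> \<open>The quadratic has degenerated to an affine function of \<open>r\<close>;
        this \<open>r\<close> gives it the value -1.\<close>
      then show False using q[of "- (A + 1) / (2 * B)"] True by (simp add: field_simps)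
    qed
    then show ?thesis using True by simp
  next
    case False
    have "0 \<le> C" unfolding C_def by (rule psd_kernel_nonneg[OF c \<psi>])
    with False have C: "C > 0" by simp
    \<comment> \<open>\<open>- B / C\<close> minimises the quadratic.\<close>
    have "A + 2 * (- B / C) * B + (- B / C)\<^sup>2 * C = A - B\<^sup>2 / C"
      using C by (simp add: field_simps power2_eq_square)
    then have "0 \<le> A - B\<^sup>2 / C" using q[of "- B / C"] by simp
    then show ?thesis using C by (simp add: field_simps)
  qed
  then show ?thesis unfolding A_def B_def C_def .
qed

lemma psd_kernel_entry_square_le:
  assumes "psd_kernel c"
  shows "(c v w)\<^sup>2 \<le> c v v * c w w"
  using psd_kernel_Cauchy_Schwarz[OF assms finite_functional_eval[of v] finite_functional_eval[of w]] .

text \<open>The subtraction lowers the quadratic form at \<open>\<phi>\<close> by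
  \<open>S\<^sup>2 / c j j\<close>, and Cauchy-Schwarz between \<open>\<phi>\<close> and the
  evaluation at \<open>j\<close> bounds this loss by the form itself. If \<open>c j j = 0\<close>,
  the quotient is 0 and nothing is subtracted.\<close>

lemma psd_kernel_Schur_complement:
  assumes c: "psd_kernel c"
  shows "psd_kernel (\<lambda>v w. c v w - c v j * c w j / c j j)"
  unfolding psd_kernel_def
proof (intro conjI allI impI)
  show "c v w - c v j * c w j / c j j = c w v - c w j * c v j / c j j" for v w
    by (simp add: psd_kernel_sym[OF c, of v w])
  fix \<phi> :: "('a \<Rightarrow> real) \<Rightarrow> real" assume \<phi>: "finite_functional \<phi>"
  define S where "S = \<phi> (\<lambda>v. c v j)"
  have "\<phi> (\<lambda>w. c v w - c v j * c w j / c j j) = \<phi> (c v) + (- S / c j j) * c v j" for v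
    using finite_functional_of_add[OF \<phi>, of "c v" "\<lambda>w. (- c v j / c j j) * c w j"]
    unfolding finite_functional_of_scale[OF \<phi>] by (simp add: S_def mult.commute)
  then have "\<phi> (\<lambda>v. \<phi> (\<lambda>w. c v w - c v j * c w j / c j j)) = \<phi> (\<lambda>v. \<phi> (c v)) + (- S / c j j) * S"
    by (simp only: finite_functional_of_add[OF \<phi>] finite_functional_of_scale[OF \<phi>] S_def[symmetric])
  then have "\<phi> (\<lambda>v. \<phi> (\<lambda>w. c v w - c v j * c w j / c j j)) = \<phi> (\<lambda>v. \<phi> (c v)) - S\<^sup>2 / c j j"
    by (simp add: power2_eq_square)
  moreover have "S\<^sup>2 / c j j \<le> \<phi> (\<lambda>v. \<phi> (c v))"
  proof -
    have "S\<^sup>2 \<le> \<phi> (\<lambda>v. \<phi> (c v)) * c j j"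
      using psd_kernel_Cauchy_Schwarz[OF c \<phi> finite_functional_eval[of j]] by (simp add: S_def)
    moreover have "0 \<le> c j j" "0 \<le> \<phi> (\<lambda>v. \<phi> (c v))"
      using psd_kernel_nonneg[OF c finite_functional_eval[of j]] psd_kernel_nonneg[OF c \<phi>] by simp_all
    ultimately show ?thesis
      by (cases "c j j = 0") (auto simp: field_simps)
  qed
  ultimately show "0 \<le> \<phi> (\<lambda>v. \<phi> (\<lambda>w. c v w - c v j * c w j / c j j))"
    by simp
qed

text \<open>Cholesky factorisation: the Schur complement at \<open>j\<close> is factorised over
  \<open>J\<close> by induction, and the rank-one part split off becomes one more
  coordinate.\<close>

lemma psd_kernel_Gram:
  assumes "finite J" "psd_kernel c"
  shows "\<exists>(\<xi> :: 'v \<Rightarrow> nat \<Rightarrow> real) n. \<forall>v\<in>J. \<forall>w\<in>J. c v w = (\<Sum>i<n. \<xi> v i * \<xi> w i)"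
  using assms
proof (induction J arbitrary: c rule: finite_induct)
  case empty
  then show ?case by simp
next
  case (insert j J)
  obtain \<xi> :: "'v \<Rightarrow> nat \<Rightarrow> real" and n where
    \<xi>: "\<And>v w. v \<in> J \<Longrightarrow> w \<in> J \<Longrightarrow> c v w - c v j * c w j / c j j = (\<Sum>i<n. \<xi> v i * \<xi> w i)"
    using insert.IH[OF psd_kernel_Schur_complement[OF insert.prems]] by blast
  have nn: "0 \<le> c j j"
    using psd_kernel_nonneg[OF insert.prems finite_functional_eval[of j]] by simp
  have z: "c v j = 0" if "c j j = 0" for v
    using psd_kernel_entry_square_le[OF insert.prems, of v j] that by simp
  \<comment> \<open>Coordinate \<open>n\<close> carries the rank-one part; the older coordinates are
    0 at \<open>j\<close>, where the Schur complement has a zero row. If \<open>c j j = 0\<close>,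
    division makes coordinate \<open>n\<close> zero, which is right because then every
    \<open>c v j\<close> vanishes.\<close>
  define \<eta> where "\<eta> v i = (if i = n then c v j / sqrt (c j j) else if v = j then 0 else \<xi> v i)" for v i
  have "c v w = (\<Sum>i<Suc n. \<eta> v i * \<eta> w i)" if "v \<in> insert j J" "w \<in> insert j J" for v w
  proof -
    have "(\<Sum>i<Suc n. \<eta> v i * \<eta> w i) = (if v = j \<or> w = j then 0 else \<Sum>i<n. \<xi> v i * \<xi> w i) + c v j * c w j / c j j"
      using nn by (auto simp: \<eta>_def intro!: sum.neutral sum.cong)
    also have "\<dots> = c v w"
      using that \<xi>[of v w] z[of v] z[of w] psd_kernel_sym[OF insert.prems, of j w]
      by (cases "c j j = 0") auto
    finally show ?thesis by simp
  qed
  then show ?case by blast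
qed

subsection \<open>Gaussian processes\<close>

lemma borel_measurable_iexp: "iexp \<in> borel_measurable borel"
  by (intro borel_measurable_continuous_onI continuous_intros)

text \<open>The centred Gaussian law with covariance \<open>c\<close>. Characteristic functions
  determine it and also admit degenerate covariances, which have no density.\<close>

definition gaussian_on :: "'v set \<Rightarrow> ('v \<Rightarrow> 'v \<Rightarrow> real) \<Rightarrow> ('v \<Rightarrow> real) measure \<Rightarrow> bool" where
  "gaussian_on I c P \<longleftrightarrow> prob_space P \<and> sets P = sets (PiM I (\<lambda>_. borel)) \<and>
     (\<forall>J t. finite J \<longrightarrow> J \<subseteq> I \<longrightarrow>
        (CLINT x|P. iexp (\<Sum>v\<in>J. t v * x v)) = exp (- (\<Sum>v\<in>J. \<Sum>w\<in>J. t v * t w * c v w) / 2))"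

lemma gaussian_on_unique: "gaussian_on I c P \<Longrightarrow> gaussian_on I c Q \<Longrightarrow> P = Q"
  unfolding gaussian_on_def by (intro PiM_eqI_char) auto

text \<open>Together with uniqueness, this is the consistency of the finite marginals that the
  extension theorem requires.\<close>

lemma gaussian_on_restrict:
  assumes "gaussian_on H c P" "J \<subseteq> H"
  shows "gaussian_on J c (distr P (PiM J (\<lambda>_. borel)) (\<lambda>x. restrict x J))"
proof -
  have P: "prob_space P" and [measurable_cong]: "sets P = sets (PiM H (\<lambda>_. borel))"
    using assms(1) by (auto simp: gaussian_on_def)
  have m: "(\<lambda>x. restrict x J) \<in> measurable P (PiM J (\<lambda>_. borel))"
    using assms(2) by (intro measurable_restrict) (auto intro!: measurable_component_singleton
        simp: measurable_cong_sets[OF \<open>sets P = _\<close> refl])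
  have "(CLINT x|distr P (PiM J (\<lambda>_. borel)) (\<lambda>x. restrict x J). iexp (\<Sum>v\<in>K. t v * x v)) =
      exp (- (\<Sum>v\<in>K. \<Sum>w\<in>K. t v * t w * c v w) / 2)" if K: "finite K" "K \<subseteq> J" for K t
  proof -
    have mK: "(\<lambda>x. x v) \<in> borel_measurable (PiM J (\<lambda>_. borel :: real measure))" if "v \<in> K" for v
      using that K(2) by (intro measurable_component_singleton) auto
    have mt: "(\<lambda>x. \<Sum>v\<in>K. t v * x v) \<in> borel_measurable (PiM J (\<lambda>_. borel))"
      using mK by (intro borel_measurable_sum borel_measurable_times) auto
    have *: "(\<Sum>v\<in>K. t v * restrict x J v) = (\<Sum>v\<in>K. t v * x v)" for x
      using K(2) by (intro sum.cong) auto
    show ?thesis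
      using K assms(1) assms(2) unfolding gaussian_on_def
      by (subst integral_distr[OF m]) (auto simp only: * intro!: borel_measurable_iexp measurable_compose[OF mt])
  qed
  then show ?thesis
    using prob_space.prob_space_distr[OF P m] by (simp add: gaussian_on_def)
qed

text \<open>The law is the image of independent standard normals under the linear map whose rows are
  the Gram vectors of \<open>c\<close>.\<close>

lemma ex_gaussian_on_finite:
  assumes J: "finite J" and c: "psd_kernel c"
  shows "\<exists>P. gaussian_on J c P"
proof -
  obtain \<xi> :: "'a \<Rightarrow> nat \<Rightarrow> real" and n where
    \<xi>: "\<And>v w. v \<in> J \<Longrightarrow> w \<in> J \<Longrightarrow> c v w = (\<Sum>i<n. \<xi> v i * \<xi> w i)"
    using psd_kernel_Gram[OF J c] by blast
  interpret N: prob_space std_normal_distribution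
    using real_dist_normal_dist by (simp add: real_distribution_def)
  interpret M: product_prob_space "\<lambda>_::nat. std_normal_distribution" "{..<n}"
    by unfold_locales
  let ?M = "PiM {..<n} (\<lambda>_. std_normal_distribution)"
  define X where "X g = (\<lambda>v\<in>J. \<Sum>i<n. \<xi> v i * g i)" for g :: "nat \<Rightarrow> real"
  have X: "X \<in> measurable ?M (PiM J (\<lambda>_. borel))"
    unfolding X_def
    by (intro measurable_restrict borel_measurable_sum borel_measurable_times) 
      (auto intro!: measurable_compose[OF measurable_component_singleton])
  have "(CLINT x|distr ?M (PiM J (\<lambda>_. borel)) X. iexp (\<Sum>v\<in>K. t v * x v)) =
      exp (- (\<Sum>v\<in>K. \<Sum>w\<in>K. t v * t w * c v w) / 2)" if K: "finite K" "K \<subseteq> J" for K t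
  proof -
    define b where "b i = (\<Sum>v\<in>K. t v * \<xi> v i)" for i
    have mK: "(\<lambda>x. x v) \<in> borel_measurable (PiM J (\<lambda>_. borel :: real measure))" if "v \<in> K" for v
      using that K(2) by (intro measurable_component_singleton) auto
    have m: "(\<lambda>x. \<Sum>v\<in>K. t v * x v) \<in> borel_measurable (PiM J (\<lambda>_. borel))"
      using mK by (intro borel_measurable_sum borel_measurable_times) auto
    have lin: "(\<Sum>v\<in>K. t v * X g v) = (\<Sum>i<n. b i * g i)" for g
    proof -
      have "(\<Sum>v\<in>K. t v * X g v) = (\<Sum>v\<in>K. \<Sum>i<n. t v * \<xi> v i * g i)"
        using K(2) by (intro sum.cong) (auto simp: X_def sum_distrib_left mult.assoc)
      also have "\<dots> = (\<Sum>i<n. b i * g i)"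
        by (subst sum.swap) (simp add: b_def sum_distrib_right)
      finally show ?thesis .
    qed
    have quad: "(\<Sum>i<n. (b i)\<^sup>2) = (\<Sum>v\<in>K. \<Sum>w\<in>K. t v * t w * c v w)"
    proof -
      have "(\<Sum>v\<in>K. \<Sum>w\<in>K. t v * t w * c v w) = (\<Sum>v\<in>K. \<Sum>w\<in>K. \<Sum>i<n. (t v * \<xi> v i) * (t w * \<xi> w i))"
        using K(2) by (intro sum.cong) (auto simp: \<xi> subset_iff sum_distrib_left mult_ac)
      also have "\<dots> = (\<Sum>v\<in>K. \<Sum>i<n. \<Sum>w\<in>K. (t v * \<xi> v i) * (t w * \<xi> w i))"
        by (intro sum.cong refl sum.swap)
      also have "\<dots> = (\<Sum>i<n. \<Sum>v\<in>K. \<Sum>w\<in>K. (t v * \<xi> v i) * (t w * \<xi> w i))"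
        by (rule sum.swap)
      also have "\<dots> = (\<Sum>i<n. (b i)\<^sup>2)"
        by (simp add: b_def power2_eq_square sum_product)
      finally show ?thesis by simp
    qed
    have "(CLINT x|distr ?M (PiM J (\<lambda>_. borel)) X. iexp (\<Sum>v\<in>K. t v * x v)) =
        (CLINT g|?M. iexp (\<Sum>i<n. b i * g i))"
      by (subst integral_distr[OF X])
        (auto simp only: lin intro!: borel_measurable_iexp measurable_compose[OF m])
    also have "\<dots> = (CLINT g|?M. (\<Prod>i<n. iexp (b i * g i)))"
      by (simp add: exp_sum sum_distrib_left)
    also have "\<dots> = (\<Prod>i<n. CLINT x|std_normal_distribution. iexp (b i * x))"
      by (rule M.product_integral_prod) (auto intro!: N.integrable_iexp)
    also have "\<dots> = (\<Prod>i<n. of_real (exp (- (b i)\<^sup>2 / 2)))"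
      by (simp only: char_std_normal_distribution[unfolded fun_eq_iff char_def, rule_format])
    also have "\<dots> = of_real (exp (- (\<Sum>i<n. (b i)\<^sup>2) / 2))"
      by (simp add: exp_sum sum_negf[symmetric] sum_divide_distrib flip: of_real_prod)
    finally show ?thesis unfolding quad .
  qed
  then have "gaussian_on J c (distr ?M (PiM J (\<lambda>_. borel)) X)"
    using M.P.prob_space_distr[OF X] by (simp add: gaussian_on_def)
  then show ?thesis by blast
qed

text \<open>Kolmogorov extension. The finite marginals are picked by choice, yet they are
  consistent, since a Gaussian law with given covariance is unique.\<close>

lemma ex_gaussian_on_UNIV:
  fixes c :: "'v \<Rightarrow> 'v \<Rightarrow> real"
  assumes c: "psd_kernel c"
  shows "\<exists>P. gaussian_on UNIV c P"
proof -
  define G where "G J = (SOME P. gaussian_on J c P)" for J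
  have G: "gaussian_on J c (G J)" if "finite J" for J
    unfolding G_def using ex_gaussian_on_finite[OF that c] by (rule someI_ex)
  interpret polish_projective "UNIV :: 'v set" G
  proof (intro polish_projective.intro projective_family.intro)
    fix J H :: "'v set" assume "J \<subseteq> H" "finite H"
    then show "G J = distr (G H) (PiM J (\<lambda>_. borel)) (\<lambda>f. restrict f J)"
      using finite_subset by (intro gaussian_on_unique[OF G gaussian_on_restrict[OF G]]) auto
  next
    show "prob_space (G J)" if "finite J" for J
      using G[OF that] by (simp add: gaussian_on_def)
  qed
  have r: "(\<lambda>x. restrict x J) \<in> measurable lim (PiM J (\<lambda>_. borel))" for J
    by (subst measurable_cong_sets[OF sets_lim refl]) simp
  have marg: "distr lim (PiM J (\<lambda>_. borel)) (\<lambda>x. restrict x J) = G J" if J: "finite J" for J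
  proof (rule measure_eqI)
    show "sets (distr lim (PiM J (\<lambda>_. borel)) (\<lambda>x. restrict x J)) = sets (G J)"
      using G[OF J] by (simp add: gaussian_on_def)
    fix A assume "A \<in> sets (distr lim (PiM J (\<lambda>_. borel)) (\<lambda>x. restrict x J))"
    then have A: "A \<in> sets (PiM J (\<lambda>_. borel))" by simp
    have "emeasure (distr lim (PiM J (\<lambda>_. borel)) (\<lambda>x. restrict x J)) A = emeasure lim (emb UNIV J A)"
      using A by (simp add: emeasure_distr[OF r] prod_emb_def space_lim space_PiM)
    also have "\<dots> = emeasure (G J) A"
      using emeasure_lim_emb[OF _ J A] by simp
    finally show "emeasure (distr lim (PiM J (\<lambda>_. borel)) (\<lambda>x. restrict x J)) A = emeasure (G J) A" .
  qed
  have "(CLINT x|lim. iexp (\<Sum>v\<in>J. t v * x v)) = exp (- (\<Sum>v\<in>J. \<Sum>w\<in>J. t v * t w * c v w) / 2)"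
    if J: "finite J" for J t
  proof -
    have m: "(\<lambda>x. \<Sum>v\<in>J. t v * x v) \<in> borel_measurable (PiM J (\<lambda>_. borel))"
      by (intro borel_measurable_sum borel_measurable_times) auto
    have *: "(\<Sum>v\<in>J. t v * restrict x J v) = (\<Sum>v\<in>J. t v * x v)" for x
      by (intro sum.cong) auto
    have "(CLINT x|lim. iexp (\<Sum>v\<in>J. t v * x v)) = (CLINT x|G J. iexp (\<Sum>v\<in>J. t v * x v))"
      unfolding marg[OF J, symmetric]
      by (subst integral_distr[OF r]) (auto simp only: * intro!: borel_measurable_iexp measurable_compose[OF m])
    then show ?thesis using G[OF J] J by (simp add: gaussian_on_def)
  qed
  then have "gaussian_on UNIV c lim"
    using P.prob_space_axioms by (simp add: gaussian_on_def sets_lim)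
  then show ?thesis ..
qed

text \<open>Characteristic functions show that the linear combination is distributed as
  \<open>\<sigma>\<close> times a standard normal, whose moments are known. Scaling a standard
  normal, instead of using a normal density, covers \<open>\<sigma> = 0\<close>.\<close>

lemma gaussian_on_second_moment:
  assumes P: "gaussian_on UNIV c P" and J: "finite J"
    and nn: "0 \<le> (\<Sum>v\<in>J. \<Sum>w\<in>J. t v * t w * c v w)"
  shows "integrable P (\<lambda>x. (\<Sum>v\<in>J. t v * x v)\<^sup>2)"
    and "(LINT x|P. (\<Sum>v\<in>J. t v * x v)\<^sup>2) = (\<Sum>v\<in>J. \<Sum>w\<in>J. t v * t w * c v w)"
proof -
  interpret P: prob_space P using P by (simp add: gaussian_on_def)
  have [measurable_cong]: "sets P = sets (PiM UNIV (\<lambda>_. borel))" using P by (simp add: gaussian_on_def)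
  interpret N: real_distribution std_normal_distribution by (rule real_dist_normal_dist)
  define \<sigma> where "\<sigma> = sqrt (\<Sum>v\<in>J. \<Sum>w\<in>J. t v * t w * c v w)"
  have \<sigma>: "\<sigma>\<^sup>2 = (\<Sum>v\<in>J. \<Sum>w\<in>J. t v * t w * c v w)" using nn by (simp add: \<sigma>_def)
  let ?Y = "\<lambda>x. \<Sum>v\<in>J. t v * x v"
  have Y[measurable]: "?Y \<in> borel_measurable P" by measurable
  have ch: "(CLINT x|P. iexp (\<Sum>v\<in>J. a v * x v)) = exp (- (\<Sum>v\<in>J. \<Sum>w\<in>J. a v * a w * c v w) / 2)" for a
    using P J by (simp add: gaussian_on_def)
  have "distr P borel ?Y = distr std_normal_distribution borel (\<lambda>x. \<sigma> * x)"
  proof (rule finite_measure_eqI_char)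
    show "finite_measure (distr P borel ?Y)" by (intro P.finite_measure_distr) simp
    show "finite_measure (distr std_normal_distribution borel (\<lambda>x. \<sigma> * x))" by (intro N.finite_measure_distr) simp
    fix s
    have "char (distr P borel ?Y) s = (CLINT x|P. iexp (\<Sum>v\<in>J. (s * t v) * x v))"
      unfolding char_def by (subst integral_distr) (auto simp: sum_distrib_left mult.assoc)
    also have "\<dots> = exp (- (\<Sum>v\<in>J. \<Sum>w\<in>J. (s * t v) * (s * t w) * c v w) / 2)"
      by (rule ch)
    also have "(\<Sum>v\<in>J. \<Sum>w\<in>J. (s * t v) * (s * t w) * c v w) = s\<^sup>2 * (\<Sum>v\<in>J. \<Sum>w\<in>J. t v * t w * c v w)"
      by (simp add: sum_distrib_left power2_eq_square mult_ac)
    also have "\<dots> = (\<sigma> * s)\<^sup>2"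
      unfolding \<sigma>[symmetric] by (simp add: power_mult_distrib)
    also have "of_real (exp (- (\<sigma> * s)\<^sup>2 / 2)) = (CLINT x|std_normal_distribution. iexp ((\<sigma> * s) * x))"
      by (simp only: char_std_normal_distribution[unfolded fun_eq_iff char_def, rule_format])
    also have "\<dots> = char (distr std_normal_distribution borel (\<lambda>x. \<sigma> * x)) s"
      unfolding char_def by (subst integral_distr) (auto simp: mult_ac)
    finally show "char (distr P borel ?Y) s = char (distr std_normal_distribution borel (\<lambda>x. \<sigma> * x)) s" .
  qed simp_all
  moreover have "integrable std_normal_distribution (\<lambda>x. (\<sigma> * x)\<^sup>2)"
    using integrable_std_normal_distribution_moment[of 2] by (simp add: power_mult_distrib)
  moreover have "(LINT x|std_normal_distribution. (\<sigma> * x)\<^sup>2) = \<sigma>\<^sup>2"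
    using std_normal_distribution_even_moments[of 1] by (simp add: power_mult_distrib)
  ultimately show "integrable P (\<lambda>x. (?Y x)\<^sup>2)" "(LINT x|P. (?Y x)\<^sup>2) = (\<Sum>v\<in>J. \<Sum>w\<in>J. t v * t w * c v w)"
    using integrable_distr_eq[of ?Y P borel "\<lambda>x. x\<^sup>2"] integral_distr[of ?Y P borel "\<lambda>x. x\<^sup>2"]
      integrable_distr_eq[of "\<lambda>x. \<sigma> * x" std_normal_distribution borel "\<lambda>x. x\<^sup>2"]
      integral_distr[of "\<lambda>x. \<sigma> * x" std_normal_distribution borel "\<lambda>x. x\<^sup>2"]
    by (simp_all add: \<sigma>[symmetric])
qed

text \<open>Polarisation of the second moments. The case \<open>v = w\<close> is separate because
  the index set \<open>{v, w}\<close> collapses there.\<close>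

lemma gaussian_on_covariance:
  assumes c: "psd_kernel c" and P: "gaussian_on UNIV c P"
  shows "integrable P (\<lambda>x. x v * x w)" and "(LINT x|P. x v * x w) = c v w"
proof -
  have nn: "0 \<le> (\<Sum>v\<in>J. \<Sum>w\<in>J. t v * t w * c v w)" if "finite J" for J t
    using psd_kernel_nonneg[OF c finite_functionalI[OF that, of t]]
    by (simp add: sum_distrib_left mult.assoc)
  have diag: "integrable P (\<lambda>x. (x v)\<^sup>2)" "(LINT x|P. (x v)\<^sup>2) = c v v" for v
    using gaussian_on_second_moment[OF P, of "{v}" "\<lambda>_. 1"] nn[of "{v}" "\<lambda>_. 1"] by simp_all
  have "integrable P (\<lambda>x. x v * x w) \<and> (LINT x|P. x v * x w) = c v w"
  proof (cases "v = w")
    case True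
    then show ?thesis using diag[of v] by (simp add: power2_eq_square)
  next
    case False
    have s: "integrable P (\<lambda>x. (x v + x w)\<^sup>2)" "(LINT x|P. (x v + x w)\<^sup>2) = c v v + c v w + (c w v + c w w)"
      using gaussian_on_second_moment[OF P, of "{v, w}" "\<lambda>_. 1"] nn[of "{v, w}" "\<lambda>_. 1"] False by simp_all
    have e: "x v * x w = ((x v + x w)\<^sup>2 - (x v)\<^sup>2 - (x w)\<^sup>2) / 2" for x :: "'a \<Rightarrow> real"
      by (simp add: power2_eq_square algebra_simps)
    show ?thesis
      unfolding e using s diag[of v] diag[of w] psd_kernel_sym[OF c, of v w] by simp
  qed
  then show "integrable P (\<lambda>x. x v * x w)" "(LINT x|P. x v * x w) = c v w" by auto
qed

text \<open>The image law is again Gaussian, and invariance of \<open>c\<close> gives it the same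
  covariance, so uniqueness applies.\<close>

lemma gaussian_on_invariant:
  assumes P: "gaussian_on UNIV c P" and \<gamma>: "bij \<gamma>" and inv: "\<And>v w. c (\<gamma> v) (\<gamma> w) = c v w"
  shows "distr P (PiM UNIV (\<lambda>_. borel)) (\<lambda>x. x \<circ> \<gamma>) = P"
proof (rule gaussian_on_unique[OF _ P])
  interpret P: prob_space P using P by (simp add: gaussian_on_def)
  have [measurable_cong]: "sets P = sets (PiM UNIV (\<lambda>_. borel))" using P by (simp add: gaussian_on_def)
  have m: "(\<lambda>x. x \<circ> \<gamma>) \<in> measurable P (PiM UNIV (\<lambda>_. borel))"
    unfolding comp_def by (rule measurable_PiM_single') auto
  have "(CLINT x|distr P (PiM UNIV (\<lambda>_. borel)) (\<lambda>x. x \<circ> \<gamma>). iexp (\<Sum>v\<in>J. t v * x v)) =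
      exp (- (\<Sum>v\<in>J. \<Sum>w\<in>J. t v * t w * c v w) / 2)" if J: "finite J" for J t
  proof -
    have mt: "(\<lambda>x. \<Sum>v\<in>J. t v * x v) \<in> borel_measurable (PiM UNIV (\<lambda>_. borel))"
      by measurable
    have inj: "inj_on \<gamma> J" using \<gamma> by (auto simp: bij_def intro: inj_on_subset)
    have [simp]: "inv \<gamma> (\<gamma> v) = v" for v using \<gamma> by (simp add: bij_def)
    have e: "(\<Sum>v\<in>J. t v * (x \<circ> \<gamma>) v) = (\<Sum>v\<in>\<gamma> ` J. t (inv \<gamma> v) * x v)" for x
      by (simp add: sum.reindex[OF inj])
    have "(CLINT x|distr P (PiM UNIV (\<lambda>_. borel)) (\<lambda>x. x \<circ> \<gamma>). iexp (\<Sum>v\<in>J. t v * x v)) =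
       (CLINT x|P. iexp (\<Sum>v\<in>\<gamma> ` J. t (inv \<gamma> v) * x v))"
      by (subst integral_distr[OF m]) (auto simp only: e intro!: borel_measurable_iexp measurable_compose[OF mt])
    also have "\<dots> = exp (- (\<Sum>v\<in>\<gamma> ` J. \<Sum>w\<in>\<gamma> ` J. t (inv \<gamma> v) * t (inv \<gamma> w) * c v w) / 2)"
      using P J by (simp add: gaussian_on_def)
    finally show ?thesis by (simp add: sum.reindex[OF inj] inv)
  qed
  then show "gaussian_on UNIV c (distr P (PiM UNIV (\<lambda>_. borel)) (\<lambda>x. x \<circ> \<gamma>))"
    using P.prob_space_distr[OF m] by (simp add: gaussian_on_def)
qed

subsection \<open>Polynomials in the adjacency operator\<close>

definition adj_poly :: "('v \<Rightarrow> 'v \<Rightarrow> bool) \<Rightarrow> real poly \<Rightarrow> ('v \<Rightarrow> real) \<Rightarrow> 'v \<Rightarrow> real" where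
  "adj_poly E p f v = (\<Sum>k\<le>degree p. coeff p k * adj_pow E k f v)"

lemma adj_poly_eq_sum:
  assumes "degree p \<le> n"
  shows "adj_poly E p f v = (\<Sum>k\<le>n. coeff p k * adj_pow E k f v)"
  unfolding adj_poly_def using assms
  by (intro sum.mono_neutral_left) (auto simp: coeff_eq_0)

lemma adj_poly_add: "adj_poly E (p + q) f v = adj_poly E p f v + adj_poly E q f v"
proof -
  let ?n = "max (degree p) (degree q)"
  have "degree (p + q) \<le> ?n" by (rule degree_add_le_max)
  then show ?thesis
    by (simp add: adj_poly_eq_sum[of _ ?n] distrib_right sum.distrib)
qed

lemma adj_poly_smult: "adj_poly E (smult a p) f v = a * adj_poly E p f v"
  by (simp add: adj_poly_eq_sum[OF degree_smult_le] adj_poly_def[of E p] sum_distrib_left mult.assoc)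

lemma adj_poly_0 [simp]: "adj_poly E 0 f v = 0"
  by (simp add: adj_poly_def)

lemma adj_poly_1 [simp]: "adj_poly E 1 f v = f v"
  by (simp add: adj_poly_def)

lemma adj_poly_pCons: "adj_poly E (pCons a p) f v = a * f v + (\<Sum>w\<in>{w. E v w}. adj_poly E p f w)"
proof -
  have "adj_poly E (pCons a p) f v = (\<Sum>k\<le>Suc (degree p). coeff (pCons a p) k * adj_pow E k f v)"
    by (rule adj_poly_eq_sum) (simp add: degree_pCons_le)
  also have "\<dots> = a * f v + (\<Sum>k\<le>degree p. coeff p k * adj_pow E (Suc k) f v)"
    by (simp only: sum.atMost_Suc_shift coeff_pCons_0 coeff_pCons_Suc adj_pow.simps(1))
  also have "(\<Sum>k\<le>degree p. coeff p k * adj_pow E (Suc k) f v) = (\<Sum>w\<in>{w. E v w}. adj_poly E p f w)"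
    by (simp add: adj_poly_def sum_distrib_left sum.swap[of _ "{..degree p}"])
  finally show ?thesis .
qed

lemma adj_poly_mult: "adj_poly E (p * q) f v = adj_poly E p (adj_poly E q f) v"
proof (induction p arbitrary: v)
  case (pCons a p)
  have "adj_poly E (pCons a p * q) f v = a * adj_poly E q f v + adj_poly E (pCons 0 (p * q)) f v"
    by (simp add: adj_poly_add adj_poly_smult)
  then show ?case by (simp add: adj_poly_pCons pCons.IH)
qed simp

lemma integral_spectral_measure_poly:
  assumes "\<And>k. integrable \<nu> (\<lambda>t::real. t ^ k)"
    and "\<And>k. (LINT t|\<nu>. t ^ k) = adj_pow E k f v"
  shows "integrable \<nu> (poly q)" and "(LINT t|\<nu>. poly q t) = adj_poly E q f v"
proof -
  have "poly q = (\<lambda>t. \<Sum>k\<le>degree q. coeff q k * t ^ k)" by (simp add: poly_altdef fun_eq_iff)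
  then show "integrable \<nu> (poly q)" "(LINT t|\<nu>. poly q t) = adj_poly E q f v"
    using assms by (simp_all add: adj_poly_def Bochner_Integration.integral_sum)
qed

section \<open>Supports of Borel measures on the line\<close>

lemma measure_support_subset_closed:
  assumes "closed S" "emeasure \<nu> (- S) = 0" "sets \<nu> = sets borel"
  shows "measure_support \<nu> \<subseteq> S"
proof
  fix t assume t: "t \<in> measure_support \<nu>"
  show "t \<in> S"
  proof (rule ccontr)
    assume "t \<notin> S"
    then obtain e where "e > 0" "ball t e \<subseteq> - S"
      using assms(1) by (metis ComplI open_Compl openE)
    then have "emeasure \<nu> (ball t e) = 0"
      using emeasure_mono[of "ball t e" "- S" \<nu>] assms by (simp add: borel_closed)
    then show False using t \<open>e > 0\<close> by (auto simp: measure_support_def)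
  qed
qed

text \<open>Every point off the support has a null ball around it, and by Lindelof countably many
  null balls cover all these points.\<close>

lemma AE_measure_support:
  assumes sets: "sets \<mu> = sets (borel :: real measure)"
  shows "AE t in \<mu>. t \<in> measure_support \<mu>"
proof -
  define \<F> where "\<F> = {ball t e | t e :: real. emeasure \<mu> (ball t e) = 0}"
  obtain \<F>' where F': "\<F>' \<subseteq> \<F>" "countable \<F>'" "\<Union>\<F>' = \<Union>\<F>"
    using Lindelof[of \<F>] by (auto simp: \<F>_def)
  have "\<Union>\<F>' \<in> null_sets \<mu>"
    using F' sets null_sets_UN'[of \<F>' "\<lambda>A. A" \<mu>] by (force simp: \<F>_def null_sets_def)
  moreover have "t \<in> \<Union>\<F>" if t: "t \<notin> measure_support \<mu>" for t
  proof -
    obtain e where "e > 0" "emeasure \<mu> (ball t e) = 0"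
      using t by (auto simp: measure_support_def zero_less_iff_neq_zero)
    then show ?thesis by (auto simp: \<F>_def intro!: exI[of _ "ball t e"])
  qed
  ultimately show ?thesis
    by (intro AE_I') (auto simp: F'(3))
qed

subsection \<open>Invariant kernels\<close>

lemma continuous_on_kernel_entry [continuous_intros]:
  "continuous_on S (\<lambda>c :: 'v \<Rightarrow> 'w \<Rightarrow> real. c v w)"
proof -
  have "continuous_on S (\<lambda>c :: 'v \<Rightarrow> 'w \<Rightarrow> real. c v)"
    by (rule continuous_on_subset[OF continuous_on_product_coordinates]) simp
  then show ?thesis by (rule continuous_on_product_then_coordinatewise)
qed

text \<open>Tychonoff, applied twice because kernels are curried.\<close>

lemma compact_bounded_kernels: "compact {c :: 'v \<Rightarrow> 'w \<Rightarrow> real. \<forall>v w. c v w \<in> {-R..R}}"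
proof -
  have PiE: "compact (PiE UNIV (\<lambda>_::'i. K))" if "compact K" for K :: "'b :: topological_space set"
    using compactin_PiE[of "\<lambda>_. euclidean" UNIV "\<lambda>_::'i. K"] that
    by (simp add: euclidean_product_topology)
  have "{c :: 'v \<Rightarrow> 'w \<Rightarrow> real. \<forall>v w. c v w \<in> {-R..R}} = PiE UNIV (\<lambda>_. PiE UNIV (\<lambda>_. {-R..R}))"
    by (auto simp: PiE_iff)
  then show ?thesis using PiE[OF PiE[OF compact_Icc]] by metis
qed

locale transitive_graph =
  fixes E :: "'v \<Rightarrow> 'v \<Rightarrow> bool" and d :: nat
  assumes regular: "regular_graph E d" and transitive: "vertex_transitive E"
begin

lemma finite_functional_adj_pow: "finite_functional (\<lambda>f. adj_pow E k f v)"
  by (induction k arbitrary: v) (auto intro!: finite_functional_sum finite_functional_eval)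

lemma finite_functional_adj_poly: "finite_functional (\<lambda>f. adj_poly E p f v)"
  unfolding adj_poly_def
  by (intro finite_functional_sum finite_functional_scale finite_functional_adj_pow)

lemma adj_pow_abs_le:
  assumes "\<And>w. \<bar>f w\<bar> \<le> M"
  shows "\<bar>adj_pow E k f v\<bar> \<le> real d ^ k * M"
proof (induction k arbitrary: v)
  case (Suc k)
  have "\<bar>adj_pow E (Suc k) f v\<bar> \<le> (\<Sum>w\<in>{w. E v w}. \<bar>adj_pow E k f w\<bar>)"
    by simp
  also have "\<dots> \<le> (\<Sum>w\<in>{w. E v w}. real d ^ k * M)"
    by (intro sum_mono Suc.IH)
  also have "\<dots> = real d ^ Suc k * M"
  proof -
    have "card {w. E v w} = d" using regular unfolding regular_graph_def by blast
    then show ?thesis by simp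
  qed
  finally show ?case .
qed (use assms in simp)

text \<open>Boundedness of \<open>p(A)\<close> in the supremum norm. The constant is uniform in
  \<open>f\<close> and \<open>v\<close>, so it can be applied in both arguments of a kernel.\<close>

lemma adj_poly_bounded: "\<exists>C\<ge>0. \<forall>(f :: 'v \<Rightarrow> real) v M. (\<forall>w. \<bar>f w\<bar> \<le> M) \<longrightarrow> \<bar>adj_poly E p f v\<bar> \<le> C * M"
proof (intro exI conjI allI impI)
  let ?C = "\<Sum>k\<le>degree p. \<bar>coeff p k\<bar> * real d ^ k"
  show "0 \<le> ?C" by (intro sum_nonneg) simp
  fix f :: "'v \<Rightarrow> real" and v and M :: real assume M: "\<forall>w. \<bar>f w\<bar> \<le> M"
  have "\<bar>adj_poly E p f v\<bar> \<le> (\<Sum>k\<le>degree p. \<bar>coeff p k * adj_pow E k f v\<bar>)"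
    unfolding adj_poly_def by (rule sum_abs)
  also have "\<dots> \<le> (\<Sum>k\<le>degree p. \<bar>coeff p k\<bar> * (real d ^ k * M))"
    using M by (intro sum_mono) (simp add: abs_mult mult_left_mono adj_pow_abs_le)
  also have "\<dots> = ?C * M" by (simp add: sum_distrib_right mult.assoc)
  finally show "\<bar>adj_poly E p f v\<bar> \<le> ?C * M" .
qed

lemma adj_pow_automorphism:
  assumes "graph_automorphism E \<gamma>"
  shows "adj_pow E k f (\<gamma> v) = adj_pow E k (\<lambda>w. f (\<gamma> w)) v"
proof (induction k arbitrary: v)
  case (Suc k)
  have \<gamma>: "bij \<gamma>" "\<And>u v. E u v \<longleftrightarrow> E (\<gamma> u) (\<gamma> v)"
    using assms by (auto simp: graph_automorphism_def)
  have "{w. E (\<gamma> v) w} = \<gamma> ` {w. E v w}"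
  proof safe
    fix w assume "E (\<gamma> v) w"
    moreover obtain u where "w = \<gamma> u" using \<gamma>(1) by (metis bij_pointE)
    ultimately show "w \<in> \<gamma> ` {w. E v w}" using \<gamma>(2) by auto
  qed (use \<gamma>(2) in auto)
  moreover have "inj_on \<gamma> {w. E v w}" using \<gamma>(1) by (auto simp: bij_def intro: inj_on_subset)
  ultimately show ?case by (simp add: sum.reindex Suc.IH)
qed simp

lemma adj_poly_automorphism:
  "graph_automorphism E \<gamma> \<Longrightarrow> adj_poly E p f (\<gamma> v) = adj_poly E p (\<lambda>w. f (\<gamma> w)) v"
  by (simp add: adj_poly_def adj_pow_automorphism)

text \<open>The abstract form of the covariance of an invariant process:
  \<open>inv_kernel_covariance\<close> and \<open>ex_invariant_process_inv_kernel\<close> give the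
  two directions.\<close>

definition inv_kernel :: "('v \<Rightarrow> 'v \<Rightarrow> real) \<Rightarrow> bool" where
  "inv_kernel c \<longleftrightarrow> psd_kernel c \<and> (\<forall>\<gamma> v w. graph_automorphism E \<gamma> \<longrightarrow> c (\<gamma> v) (\<gamma> w) = c v w)"

lemma inv_kernel_diag:
  assumes "inv_kernel c"
  shows "c v v = c w w"
proof -
  obtain \<gamma> where "graph_automorphism E \<gamma>" "\<gamma> w = v"
    using transitive unfolding vertex_transitive_def by blast
  then show ?thesis using assms by (auto simp: inv_kernel_def)
qed

lemma inv_kernel_diag_nonneg: "inv_kernel c \<Longrightarrow> 0 \<le> c v v"
  using psd_kernel_nonneg[OF _ finite_functional_eval[of v]] by (simp add: inv_kernel_def)

text \<open>Transitivity makes the diagonal constant, and Cauchy-Schwarz bounds all entries by it;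
  one number thus controls the whole kernel.\<close>

lemma inv_kernel_abs_le:
  assumes "inv_kernel c"
  shows "\<bar>c v w\<bar> \<le> c u u"
proof -
  have "(c v w)\<^sup>2 \<le> (c u u)\<^sup>2"
    using psd_kernel_entry_square_le[of c v w] assms inv_kernel_diag[OF assms, of v u] inv_kernel_diag[OF assms, of w u]
    by (simp add: inv_kernel_def power2_eq_square)
  then show ?thesis
    using inv_kernel_diag_nonneg[OF assms, of u] by (simp add: abs_le_square_iff[symmetric])
qed

lemma inv_kernel_combination:
  assumes c: "inv_kernel c" and c': "inv_kernel c'" and r: "0 \<le> r" and s: "0 \<le> s"
  shows "inv_kernel (\<lambda>v w. r * c v w + s * c' v w)"
proof -
  have "0 \<le> \<phi> (\<lambda>v. \<phi> (\<lambda>w. r * c v w + s * c' v w))" if \<phi>: "finite_functional \<phi>" for \<phi>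
  proof -
    have "\<phi> (\<lambda>v. \<phi> (\<lambda>w. r * c v w + s * c' v w)) = r * \<phi> (\<lambda>v. \<phi> (\<lambda>w. c v w)) + s * \<phi> (\<lambda>v. \<phi> (\<lambda>w. c' v w))"
      by (simp only: finite_functional_of_add[OF \<phi>] finite_functional_of_scale[OF \<phi>])
    then show ?thesis
      using c c' r s psd_kernel_nonneg[OF _ \<phi>] by (simp add: inv_kernel_def)
  qed
  then show ?thesis
    using c c' by (auto simp: inv_kernel_def psd_kernel_def)
qed

lemma inv_kernel_zero: "inv_kernel (\<lambda>_ _. 0)"
proof -
  have "\<phi> (\<lambda>_. 0) = 0" if "finite_functional \<phi>" for \<phi> :: "('v \<Rightarrow> real) \<Rightarrow> real"
    using finite_functional_of_scale[OF that, of 0 "\<lambda>_. 0"] by simp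
  then have "\<phi> (\<lambda>_. \<phi> (\<lambda>_. 0)) = 0" if "finite_functional \<phi>" for \<phi> :: "('v \<Rightarrow> real) \<Rightarrow> real"
    using that by metis
  then show ?thesis unfolding inv_kernel_def psd_kernel_def by (metis order_refl)
qed

section \<open>Accretive polynomials and the growth of the powers of
  \<open>1 - \<epsilon> p(A)\<close>\<close>

text \<open>For a process with covariance \<open>c\<close> the quantity is the expectation of
  \<open>(p(A) X)_\<rho> * X_\<rho>\<close>. Under the pairing of coefficients with moments, these
  polynomials form the cone dual to the invariant kernels.\<close>

definition accretive :: "'v \<Rightarrow> real poly \<Rightarrow> bool" where
  "accretive \<rho> p \<longleftrightarrow> (\<forall>c. inv_kernel c \<longrightarrow> 0 \<le> adj_poly E p (\<lambda>w. c w \<rho>) \<rho>)"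

text \<open>The covariance of \<open>p(A) X\<close> when \<open>c\<close> is the covariance of
  \<open>X\<close>.\<close>

definition adj_kernel :: "real poly \<Rightarrow> ('v \<Rightarrow> 'v \<Rightarrow> real) \<Rightarrow> 'v \<Rightarrow> 'v \<Rightarrow> real" where
  "adj_kernel p c v w = adj_poly E p (\<lambda>u. adj_poly E p (c u) w) v"

text \<open>The operator moves into the functional: the form of the new kernel at
  \<open>\<phi>\<close> is the form of \<open>c\<close> at \<open>\<phi>\<close> composed with
  \<open>p(A)\<close>. Invariance holds because \<open>p(A)\<close> commutes with
  automorphisms.\<close>

lemma inv_kernel_adj_kernel:
  assumes c: "inv_kernel c"
  shows "inv_kernel (adj_kernel p c)"
proof -
  have sym: "c v w = c w v" for v w using c by (simp add: inv_kernel_def psd_kernel_sym)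
  have "adj_kernel p c v w = adj_kernel p c w v" for v w
  proof -
    have "adj_kernel p c v w = adj_poly E p (\<lambda>u'. adj_poly E p (\<lambda>u. c u u') v) w"
      unfolding adj_kernel_def
      by (rule finite_functional_swap[OF finite_functional_adj_poly finite_functional_adj_poly])
    also have "\<dots> = adj_poly E p (\<lambda>u'. adj_poly E p (c u') v) w"
      by (subst sym) (rule refl)
    finally show ?thesis by (simp only: adj_kernel_def)
  qed
  moreover have "0 \<le> \<phi> (\<lambda>v. \<phi> (\<lambda>w. adj_kernel p c v w))" if \<phi>: "finite_functional \<phi>" for \<phi>
  proof -
    define \<psi> where "\<psi> f = \<phi> (\<lambda>v. adj_poly E p f v)" for f
    have \<psi>: "finite_functional \<psi>"
      unfolding \<psi>_def by (rule finite_functional_compose[OF \<phi> finite_functional_adj_poly])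
    have "\<phi> (\<lambda>w. adj_kernel p c v w) = adj_poly E p (\<lambda>u. \<psi> (c u)) v" for v
      unfolding adj_kernel_def \<psi>_def
      by (rule finite_functional_swap[OF \<phi> finite_functional_adj_poly])
    then have "\<phi> (\<lambda>v. \<phi> (\<lambda>w. adj_kernel p c v w)) = \<psi> (\<lambda>u. \<psi> (c u))"
      by (simp add: \<psi>_def)
    then show ?thesis
      using psd_kernel_nonneg[OF _ \<psi>] c by (simp add: inv_kernel_def)
  qed
  moreover have "adj_kernel p c (\<gamma> v) (\<gamma> w) = adj_kernel p c v w" if "graph_automorphism E \<gamma>" for \<gamma> v w
    using c that by (simp add: adj_kernel_def adj_poly_automorphism inv_kernel_def)
  ultimately show ?thesis unfolding inv_kernel_def psd_kernel_def by blast
qed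

text \<open>Operators that act on different arguments of a kernel commute by
  \<open>finite_functional_swap\<close>.\<close>

lemma adj_kernel_mult: "adj_kernel p (adj_kernel q c) = adj_kernel (p * q) c"
proof (intro ext)
  fix v w
  have "adj_poly E p (adj_kernel q c u) w = adj_poly E q (\<lambda>x. adj_poly E p (adj_poly E q (c x)) w) u" for u
    unfolding adj_kernel_def
    by (rule finite_functional_swap[OF finite_functional_adj_poly finite_functional_adj_poly])
  then show "adj_kernel p (adj_kernel q c) v w = adj_kernel (p * q) c v w"
    by (simp add: adj_kernel_def[of p] adj_kernel_def[of "p * q"] adj_poly_mult)
qed

lemma adj_kernel_1 [simp]: "adj_kernel 1 c = c"
  by (simp add: adj_kernel_def fun_eq_iff)

text \<open>In the variance of \<open>X - \<epsilon> p(A) X\<close> at \<open>\<rho>\<close> the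
  cross term is \<open>-2 \<epsilon>\<close> times a nonnegative number. Only the term of order
  \<open>\<epsilon>\<^sup>2\<close> can increase the variance, and it is bounded by using
  \<open>C\<close> once in each argument.\<close>

lemma adj_kernel_accretive_step:
  assumes c: "inv_kernel c" and p: "0 \<le> adj_poly E p (\<lambda>w. c w \<rho>) \<rho>" and \<epsilon>: "0 \<le> \<epsilon>"
    and C: "0 \<le> C" "\<And>f v M. (\<forall>w. \<bar>f w\<bar> \<le> M) \<Longrightarrow> \<bar>adj_poly E p f v\<bar> \<le> C * M"
  shows "adj_kernel (1 - smult \<epsilon> p) c \<rho> \<rho> \<le> (1 + \<epsilon>\<^sup>2 * C\<^sup>2) * c \<rho> \<rho>"
proof -
  have psd: "psd_kernel c" using c by (simp add: inv_kernel_def)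
  have L: "adj_poly E (1 - smult \<epsilon> p) f v = f v + (- \<epsilon>) * adj_poly E p f v" for f v
    using adj_poly_add[of E 1 "smult (- \<epsilon>) p" f v] adj_poly_smult[of E "- \<epsilon>" p f v] by simp
  have "adj_kernel (1 - smult \<epsilon> p) c \<rho> \<rho> =
      c \<rho> \<rho> + 2 * (- \<epsilon>) * adj_poly E p (c \<rho>) \<rho> + (- \<epsilon>)\<^sup>2 * adj_kernel p c \<rho> \<rho>"
    using psd_kernel_expand[OF psd finite_functional_eval[of \<rho>] finite_functional_adj_poly[of p \<rho>], of "- \<epsilon>"]
    unfolding adj_kernel_def L by simp
  \<comment> \<open>The expansion produces a row of \<open>c\<close>, the hypothesis concerns a
    column.\<close>
  also have "c \<rho> = (\<lambda>w. c w \<rho>)" using psd_kernel_sym[OF psd] by (simp add: fun_eq_iff)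
  finally have "adj_kernel (1 - smult \<epsilon> p) c \<rho> \<rho> \<le> c \<rho> \<rho> + \<epsilon>\<^sup>2 * adj_kernel p c \<rho> \<rho>"
    using p \<epsilon> by simp
  moreover have "\<bar>adj_kernel p c \<rho> \<rho>\<bar> \<le> C * (C * c \<rho> \<rho>)"
    unfolding adj_kernel_def using inv_kernel_abs_le[OF c] by (intro C(2) allI) auto
  then have "\<epsilon>\<^sup>2 * adj_kernel p c \<rho> \<rho> \<le> \<epsilon>\<^sup>2 * (C * (C * c \<rho> \<rho>))"
    by (intro mult_left_mono) auto
  ultimately show ?thesis by (simp add: algebra_simps power2_eq_square)
qed

text \<open>The covariance of \<open>L^n X\<close> is again an invariant kernel, so the one-step
  estimate iterates. Cauchy-Schwarz between \<open>(L^n X)_\<rho>\<close> and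
  \<open>X_\<rho>\<close> then bounds the square of the mixed moment with exponent \<open>n\<close>
  instead of \<open>2 * n\<close>.\<close>

lemma adj_kernel_accretive_power:
  assumes p: "accretive \<rho> p" and c: "inv_kernel c" and \<epsilon>: "0 \<le> \<epsilon>"
    and C: "0 \<le> C" "\<And>f v M. (\<forall>w. \<bar>f w\<bar> \<le> M) \<Longrightarrow> \<bar>adj_poly E p f v\<bar> \<le> C * M"
  shows "(adj_poly E ((1 - smult \<epsilon> p) ^ n) (\<lambda>w. c w \<rho>) \<rho>)\<^sup>2 \<le> (1 + \<epsilon>\<^sup>2 * C\<^sup>2) ^ n * (c \<rho> \<rho>)\<^sup>2"
proof -
  define L where "L = 1 - smult \<epsilon> p"
  have "adj_kernel (L ^ n) c \<rho> \<rho> \<le> (1 + \<epsilon>\<^sup>2 * C\<^sup>2) ^ n * c \<rho> \<rho>"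
  proof (induction n)
    case (Suc n)
    have inv: "inv_kernel (adj_kernel (L ^ n) c)" by (rule inv_kernel_adj_kernel[OF c])
    have "adj_kernel (L ^ Suc n) c \<rho> \<rho> \<le> (1 + \<epsilon>\<^sup>2 * C\<^sup>2) * adj_kernel (L ^ n) c \<rho> \<rho>"
      using adj_kernel_accretive_step[OF inv _ \<epsilon> C, of \<rho>] p inv by (simp add: adj_kernel_mult L_def accretive_def)
    also have "\<dots> \<le> (1 + \<epsilon>\<^sup>2 * C\<^sup>2) * ((1 + \<epsilon>\<^sup>2 * C\<^sup>2) ^ n * c \<rho> \<rho>)"
      by (intro mult_left_mono Suc.IH) simp
    finally show ?case by (simp add: mult.assoc)
  qed simp
  moreover have "(adj_poly E (L ^ n) (\<lambda>w. c w \<rho>) \<rho>)\<^sup>2 \<le> adj_kernel (L ^ n) c \<rho> \<rho> * c \<rho> \<rho>"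
    using psd_kernel_Cauchy_Schwarz[OF _ finite_functional_adj_poly[of "L ^ n" \<rho>] finite_functional_eval[of \<rho>], of c] c
    by (simp add: inv_kernel_def adj_kernel_def)
  ultimately have "(adj_poly E (L ^ n) (\<lambda>w. c w \<rho>) \<rho>)\<^sup>2 \<le> (1 + \<epsilon>\<^sup>2 * C\<^sup>2) ^ n * c \<rho> \<rho> * c \<rho> \<rho>"
    using mult_right_mono[OF _ inv_kernel_diag_nonneg[OF c, of \<rho>]] order_trans by blast
  then show ?thesis by (simp add: L_def power2_eq_square mult.assoc)
qed

section \<open>From invariant processes to kernels, and positivity on the process spectrum\<close>

lemma inv_kernel_covariance:
  assumes P: "invariant_process E P" and sq: "integrable P (\<lambda>x. (x \<rho>)\<^sup>2)"
  shows "integrable P (\<lambda>x. x v * x w)" and "inv_kernel (\<lambda>v w. LINT x|P. x v * x w)"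
proof -
  have [measurable_cong]: "sets P = sets config_space"
    and inv: "\<And>\<gamma>. graph_automorphism E \<gamma> \<Longrightarrow> distr P config_space (\<lambda>x. x \<circ> \<gamma>) = P"
    using P by (auto simp: invariant_process_def)
  have m: "(\<lambda>x. x \<circ> \<gamma>) \<in> measurable P config_space" for \<gamma> :: "'v \<Rightarrow> 'v"
    unfolding comp_def by (rule measurable_PiM_single') auto
  \<comment> \<open>The second moment is assumed finite at \<open>\<rho>\<close> only; transitivity
    carries this to every vertex.\<close>
  have sq_all: "integrable P (\<lambda>x. (x v)\<^sup>2)" for v
  proof -
    obtain \<gamma> where \<gamma>: "graph_automorphism E \<gamma>" "\<gamma> \<rho> = v"
      using transitive unfolding vertex_transitive_def by blast
    have "integrable (distr P config_space (\<lambda>x. x \<circ> \<gamma>)) (\<lambda>x. (x \<rho>)\<^sup>2)"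
      using sq inv[OF \<gamma>(1)] by simp
    then show ?thesis
      by (subst (asm) integrable_distr_eq[OF m]) (simp_all add: \<gamma>(2))
  qed
  show int: "integrable P (\<lambda>x. x v * x w)" for v w
  proof (rule Bochner_Integration.integrable_bound[OF Bochner_Integration.integrable_add[OF sq_all[of v] sq_all[of w]]])
    have "\<bar>a * b\<bar> \<le> a\<^sup>2 + b\<^sup>2" for a b :: real
    proof -
      have "2 * \<bar>a * b\<bar> \<le> a\<^sup>2 + b\<^sup>2"
        using sum_squares_bound[of "\<bar>a\<bar>" "\<bar>b\<bar>"] by (simp add: abs_mult mult.assoc)
      then show ?thesis using abs_ge_zero[of "a * b"] by linarith
    qed
    then show "AE x in P. norm (x v * x w) \<le> norm ((x v)\<^sup>2 + (x w)\<^sup>2)" by simp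
  qed measurable
  \<comment> \<open>The quadratic form at \<open>\<phi>\<close> is the expectation of the square of
    \<open>\<phi> x\<close>.\<close>
  have "0 \<le> \<phi> (\<lambda>v. \<phi> (\<lambda>w. LINT x|P. x v * x w))" if \<phi>: "finite_functional \<phi>" for \<phi>
  proof -
    have *: "\<phi> (\<lambda>w. x v * x w) = \<phi> x * x v" for x :: "'v \<Rightarrow> real" and v
      by (simp add: finite_functional_of_scale[OF \<phi>])
    have i: "integrable P (\<lambda>x. \<phi> x * x v)" "(LINT x|P. \<phi> x * x v) = \<phi> (\<lambda>w. LINT x|P. x v * x w)" for v
      using finite_functional_integral[OF \<phi>, of P "\<lambda>w x. x v * x w"] int by (simp_all add: *)
    have "(LINT x|P. \<phi> (\<lambda>v. \<phi> x * x v)) = \<phi> (\<lambda>v. \<phi> (\<lambda>w. LINT x|P. x v * x w))"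
      using finite_functional_integral(2)[OF \<phi> i(1)] by (simp add: i(2))
    moreover have "\<phi> (\<lambda>v. \<phi> x * x v) = (\<phi> x)\<^sup>2" for x :: "'v \<Rightarrow> real"
      by (simp add: finite_functional_of_scale[OF \<phi>] power2_eq_square)
    ultimately show ?thesis by (metis (no_types, lifting) Bochner_Integration.integral_nonneg zero_le_power2)
  qed
  moreover have "(LINT x|P. x (\<gamma> v) * x (\<gamma> w)) = (LINT x|P. x v * x w)" if "graph_automorphism E \<gamma>" for \<gamma> v w
    using integral_distr[OF m[of \<gamma>], of "\<lambda>x. x v * x w"] inv[OF that] by simp
  moreover have "(LINT x|P. x v * x w) = (LINT x|P. x w * x v)" for v w
    by (simp add: mult.commute)
  ultimately show "inv_kernel (\<lambda>v w. LINT x|P. x v * x w)"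
    unfolding inv_kernel_def psd_kernel_def by blast
qed

lemma integral_adj_pow:
  assumes "\<And>v w :: 'v. integrable P (\<lambda>x. x v * x w)"
  shows "integrable P (\<lambda>x. adj_pow E k x \<rho> * x \<rho>)"
    and "(LINT x|P. adj_pow E k x \<rho> * x \<rho>) = adj_pow E k (\<lambda>w. LINT x|P. x w * x \<rho>) \<rho>"
proof -
  have "adj_pow E k (\<lambda>w. x w * x \<rho>) \<rho> = adj_pow E k x \<rho> * x \<rho>" for x :: "'v \<Rightarrow> real"
    using finite_functional_of_scale[OF finite_functional_adj_pow[of k \<rho>], where r = "x \<rho>" and f = x] by (simp add: mult.commute)
  then show "integrable P (\<lambda>x. adj_pow E k x \<rho> * x \<rho>)"
    "(LINT x|P. adj_pow E k x \<rho> * x \<rho>) = adj_pow E k (\<lambda>w. LINT x|P. x w * x \<rho>) \<rho>"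
    using finite_functional_integral[OF finite_functional_adj_pow[of k \<rho>], of P "\<lambda>w x. x w * x \<rho>"] assms
    by simp_all
qed

text \<open>If \<open>p\<close> were negative at a point of the support of \<open>\<nu>\<close>,
  then \<open>L = 1 - \<epsilon> p\<close> would be at least \<open>x > 1\<close> on a ball of mass
  \<open>\<delta> > 0\<close>, so the integral of \<open>L ^ (2 * m)\<close> would be at least
  \<open>x ^ (2 * m) * \<delta>\<close>. By accretivity its square is at most
  \<open>x ^ (2 * m)\<close> times a constant, which fails for large \<open>m\<close>.\<close>

lemma poly_nonneg_on_process_spectrum:
  assumes p: "accretive \<rho> p"
    and t: "t \<in> process_spectrum E d \<rho>"
  shows "0 \<le> poly p t"
proof -
  have supp: "0 \<le> poly p t"
    if P: "invariant_process E P" and sq: "integrable P (\<lambda>x. (x \<rho>)\<^sup>2)"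
      and \<nu>: "spectral_measure_of E d \<rho> P \<nu>" and t: "t \<in> measure_support \<nu>" for P \<nu> t
  proof (rule ccontr)
    assume neg: "\<not> 0 \<le> poly p t"
    define c where "c = (\<lambda>v w. LINT x|P. x v * x w)"
    have c: "inv_kernel c" unfolding c_def by (rule inv_kernel_covariance[OF P sq])
    interpret \<nu>: finite_measure \<nu> using \<nu> by (simp add: spectral_measure_of_def)
    have [measurable_cong]: "sets \<nu> = sets borel" using \<nu> by (simp add: spectral_measure_of_def)
    have int_k: "integrable \<nu> (\<lambda>t. t ^ k)" for k using \<nu> by (simp add: spectral_measure_of_def)
    have mom: "(LINT t|\<nu>. t ^ k) = adj_pow E k (\<lambda>w. c w \<rho>) \<rho>" for k
      using \<nu> integral_adj_pow(2)[OF inv_kernel_covariance(1)[OF P sq], of k \<rho>]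
      by (simp add: spectral_measure_of_def c_def)
    note int_poly = integral_spectral_measure_poly[OF int_k mom]
    \<comment> \<open>Half of the gap at \<open>t\<close>, so that \<open>p\<close> stays below
      \<open>- \<eta>\<close> on a whole ball.\<close>
    define \<eta> where "\<eta> = - poly p t / 2"
    have \<eta>: "\<eta> > 0" using neg by (simp add: \<eta>_def)
    have "isCont (poly p) t" by (rule poly_isCont)
    then obtain e where e: "e > 0" "\<And>s. dist s t < e \<Longrightarrow> dist (poly p s) (poly p t) < \<eta>"
      using \<eta> unfolding continuous_at_eps_delta by blast
    have p_neg: "poly p s \<le> - \<eta>" if "s \<in> ball t e" for s
      using e(2)[of s] that by (auto simp: dist_commute dist_real_def \<eta>_def)
    define \<delta> where "\<delta> = measure \<nu> (ball t e)"
    have \<delta>: "\<delta> > 0"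
      using t e(1) by (auto simp: measure_support_def \<delta>_def \<nu>.emeasure_eq_measure)
    obtain C where C: "0 \<le> C" "\<And>f v M. (\<forall>w. \<bar>f w\<bar> \<le> M) \<Longrightarrow> \<bar>adj_poly E p f v\<bar> \<le> C * M"
      using adj_poly_bounded by blast
    \<comment> \<open>Small enough that the accretive growth
      \<open>\<epsilon>\<^sup>2 * C\<^sup>2\<close> does not exceed the gain
      \<open>\<epsilon> * \<eta>\<close>. The added 1 covers \<open>C = 0\<close>.\<close>
    define \<epsilon> where "\<epsilon> = \<eta> / (C\<^sup>2 + 1)"
    have C1: "C\<^sup>2 + 1 > 0" by (simp add: add_nonneg_pos)
    have \<epsilon>: "\<epsilon> > 0" using \<eta> C1 by (simp add: \<epsilon>_def)
    define x where "x = 1 + \<epsilon> * \<eta>"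
    have x: "x > 1" using \<epsilon> \<eta> by (simp add: x_def)
    have growth: "1 + \<epsilon>\<^sup>2 * C\<^sup>2 \<le> x"
    proof -
      have "\<epsilon> * C\<^sup>2 \<le> \<epsilon> * (C\<^sup>2 + 1)" using \<epsilon> by (intro mult_left_mono) auto
      also have "\<dots> = \<eta>" using C1 by (simp add: \<epsilon>_def)
      finally have "\<epsilon> * (\<epsilon> * C\<^sup>2) \<le> \<epsilon> * \<eta>" using \<epsilon> by (intro mult_left_mono) auto
      then show ?thesis by (simp add: x_def power2_eq_square mult.assoc)
    qed
    define L where "L = 1 - smult \<epsilon> p"
    have bound: "x ^ (2 * m) * \<delta>\<^sup>2 \<le> (c \<rho> \<rho>)\<^sup>2" for m
    proof -
      have "x ^ (2 * m) * \<delta> = (LINT s|\<nu>. x ^ (2 * m) * indicator (ball t e) s)"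
        by (simp add: \<delta>_def)
      also have "\<dots> \<le> (LINT s|\<nu>. poly (L ^ (2 * m)) s)"
      proof (rule integral_mono)
        show "integrable \<nu> (\<lambda>s. x ^ (2 * m) * indicator (ball t e) s)"
          by (intro integrable_mult_right integrable_real_indicator) (auto simp: \<nu>.emeasure_eq_measure)
        show "integrable \<nu> (poly (L ^ (2 * m)))" by (rule int_poly)
        fix s
        show "x ^ (2 * m) * indicator (ball t e) s \<le> poly (L ^ (2 * m)) s"
        proof (cases "s \<in> ball t e")
          case True
          have "\<epsilon> * poly p s \<le> \<epsilon> * (- \<eta>)" using p_neg[OF True] \<epsilon> by (intro mult_left_mono) auto
          then have "x \<le> poly L s" by (simp add: L_def x_def)
          then show ?thesis using True x by (simp add: poly_power power_mono)
        next
          case False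
          \<comment> \<open>Off the ball the sign of \<open>L\<close> is unknown; the even exponent
            makes its power nonnegative.\<close>
          then show ?thesis by (simp add: poly_power)
        qed
      qed
      also have "\<dots> = adj_poly E (L ^ (2 * m)) (\<lambda>w. c w \<rho>) \<rho>" by (rule int_poly)
      finally have "(x ^ (2 * m) * \<delta>)\<^sup>2 \<le> (adj_poly E (L ^ (2 * m)) (\<lambda>w. c w \<rho>) \<rho>)\<^sup>2"
        using x \<delta> by (intro power_mono) auto
      also have "\<dots> \<le> (1 + \<epsilon>\<^sup>2 * C\<^sup>2) ^ (2 * m) * (c \<rho> \<rho>)\<^sup>2"
        unfolding L_def using \<epsilon> by (intro adj_kernel_accretive_power[OF p c _ C]) auto
      also have "\<dots> \<le> x ^ (2 * m) * (c \<rho> \<rho>)\<^sup>2"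
        using growth by (intro mult_right_mono power_mono) auto
      \<comment> \<open>The squared lower bound has exponent \<open>4 * m\<close>, the upper bound
        only \<open>2 * m\<close>; after cancelling, an unbounded factor remains on the
        left.\<close>
      finally have "x ^ (2 * m) * (x ^ (2 * m) * \<delta>\<^sup>2) \<le> x ^ (2 * m) * (c \<rho> \<rho>)\<^sup>2"
        by (simp add: power_mult_distrib power2_eq_square mult_ac)
      then show ?thesis using x by (subst (asm) mult_le_cancel_left_pos) auto
    qed
    obtain m where "(c \<rho> \<rho>)\<^sup>2 / \<delta>\<^sup>2 < (x\<^sup>2) ^ m"
      using real_arch_pow[of "x\<^sup>2"] x by (auto simp: one_less_power)
    then show False
      using bound[of m] \<delta> unfolding power_mult[of x 2 m] by (simp add: field_simps)
  qed
  \<comment> \<open>The set where \<open>p\<close> is nonnegative is closed, so it also contains the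
    closure of the union of the supports.\<close>
  have "\<Union> {measure_support \<mu> | P \<mu>. invariant_process E P \<and> integrable P (\<lambda>x. (x \<rho>)\<^sup>2) \<and>
      spectral_measure_of E d \<rho> P \<mu>} \<subseteq> {t. 0 \<le> poly p t}"
    using supp by blast
  then have "process_spectrum E d \<rho> \<subseteq> {t. 0 \<le> poly p t}"
    unfolding process_spectrum_def
    by (rule closure_minimal) (intro closed_Collect_le continuous_intros)
  then show ?thesis using t by blast
qed

lemma process_spectrum_bounded: "process_spectrum E d \<rho> \<subseteq> {- real d..real d}"
  unfolding process_spectrum_def
proof (rule closure_minimal)
  show "\<Union> {measure_support \<mu> | P \<mu>. invariant_process E P \<and> integrable P (\<lambda>x. (x \<rho>)\<^sup>2) \<and>
      spectral_measure_of E d \<rho> P \<mu>} \<subseteq> {- real d..real d}"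
    using measure_support_subset_closed[of "{- real d..real d}"]
    by (auto simp: spectral_measure_of_def simp del: atLeastAtMost_iff)
qed simp

text \<open>The diagonal bound confines the kernels to a compact cube, and each defining condition
  involves finitely many entries, hence is closed in the product topology.\<close>

lemma compact_inv_kernels: "compact {c. inv_kernel c \<and> c \<rho> \<rho> \<le> R}"
proof -
  let ?B = "{c :: 'v \<Rightarrow> 'v \<Rightarrow> real. \<forall>v w. c v w \<in> {-R..R}}"
  have "{c. inv_kernel c \<and> c \<rho> \<rho> \<le> R} \<subseteq> ?B"
  proof clarify
    fix c v w assume c: "inv_kernel c" "c \<rho> \<rho> \<le> R"
    then show "c v w \<in> {-R..R}" using inv_kernel_abs_le[OF c(1), of v w \<rho>] by auto
  qed
  then have eq: "{c. inv_kernel c \<and> c \<rho> \<rho> \<le> R} = ?B \<inter> {c. inv_kernel c \<and> c \<rho> \<rho> \<le> R}" by blast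
  have closed_eq: "closed {c :: 'v \<Rightarrow> 'v \<Rightarrow> real. c v w = c v' w'}" for v w v' w'
    by (intro closed_Collect_eq continuous_on_kernel_entry)
  have pos: "closed {c :: 'v \<Rightarrow> 'v \<Rightarrow> real. 0 \<le> \<phi> (\<lambda>v. \<phi> (\<lambda>w. c v w))}"
    if \<phi>: "finite_functional \<phi>" for \<phi>
    by (rule closed_Collect_le[OF continuous_on_const finite_functional_continuous[OF \<phi>
        finite_functional_continuous[OF \<phi> continuous_on_kernel_entry]]])
  have "{c. inv_kernel c \<and> c \<rho> \<rho> \<le> R} =
      (\<Inter>v. \<Inter>w. {c. c v w = c w v}) \<inter>
      (\<Inter>\<phi>\<in>Collect finite_functional. {c. 0 \<le> \<phi> (\<lambda>v. \<phi> (\<lambda>w. c v w))}) \<inter>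
      (\<Inter>\<gamma>\<in>Collect (graph_automorphism E). \<Inter>v. \<Inter>w. {c. c (\<gamma> v) (\<gamma> w) = c v w}) \<inter> {c. c \<rho> \<rho> \<le> R}"
    by (auto simp: inv_kernel_def psd_kernel_def)
  also have "closed \<dots>"
    by (intro closed_Int closed_INT ballI closed_eq pos closed_Collect_le continuous_on_kernel_entry
        continuous_on_const) simp
  finally show ?thesis
    by (subst eq) (intro compact_Int_closed compact_bounded_kernels)
qed

lemma continuous_on_moment: "continuous_on S (\<lambda>c. adj_pow E k (\<lambda>w. c w \<rho>) \<rho>)"
  by (rule finite_functional_continuous[OF finite_functional_adj_pow continuous_on_kernel_entry])

lemma moment_combination:
  "adj_pow E k (\<lambda>w. r * c w \<rho> + s * c' w \<rho>) \<rho> = r * adj_pow E k (\<lambda>w. c w \<rho>) \<rho> + s * adj_pow E k (\<lambda>w. c' w \<rho>) \<rho>"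
  by (simp only: finite_functional_of_add[OF finite_functional_adj_pow]
      finite_functional_of_scale[OF finite_functional_adj_pow])

end

section \<open>The moment problem for invariant kernels, by separation and compactness\<close>

lemma first_order_nonneg:
  assumes "\<And>\<epsilon>. 0 < \<epsilon> \<Longrightarrow> \<epsilon> \<le> 1 \<Longrightarrow> 0 \<le> 2 * \<epsilon> * a + \<epsilon>\<^sup>2 * (b :: real)"
  shows "0 \<le> a"
proof (rule ccontr)
  assume "\<not> 0 \<le> a"
  then have a: "a < 0" by simp
  \<comment> \<open>Chosen so that \<open>\<epsilon> * \<bar>b\<bar>\<close> is at most
    \<open>- a\<close>; the linear term then dominates.\<close>
  define \<epsilon> where "\<epsilon> = min 1 (- a / (\<bar>b\<bar> + 1))"
  have \<epsilon>: "0 < \<epsilon>" "\<epsilon> \<le> 1" "\<epsilon> \<le> - a / (\<bar>b\<bar> + 1)"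
    using a by (auto simp: \<epsilon>_def divide_neg_pos add_nonneg_pos)
  have "\<epsilon> * b \<le> \<epsilon> * (\<bar>b\<bar> + 1)" using \<epsilon>(1) by (intro mult_left_mono) auto
  also have "\<dots> \<le> - a" using \<epsilon>(3) by (subst (asm) pos_le_divide_eq) (auto simp: add_nonneg_pos)
  finally have "2 * a + \<epsilon> * b < 0" using a by simp
  then have "\<epsilon> * (2 * a + \<epsilon> * b) < 0" using \<epsilon>(1) by (simp add: mult_pos_neg)
  then show False using assms[OF \<epsilon>(1,2)] by (simp add: power2_eq_square algebra_simps)
qed

context transitive_graph
begin

text \<open>The hyperplane separating the moments of \<open>\<mu>\<close> from those of the kernels is found by hand, as
  the gradient of the squared distance at a minimiser.\<close>

lemma ex_inv_kernel_finite_moments: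
  fixes a :: "nat \<Rightarrow> real"
  assumes sep: "\<And>p. accretive \<rho> p \<Longrightarrow> 0 \<le> (\<Sum>k\<le>degree p. coeff p k * a k)"
  shows "\<exists>c. inv_kernel c \<and> (\<forall>k\<le>N. adj_pow E k (\<lambda>w. c w \<rho>) \<rho> = a k)"
proof -
  define m where "m k c = adj_pow E k (\<lambda>w. c w \<rho>) \<rho>" for k and c :: "'v \<Rightarrow> 'v \<Rightarrow> real"
  define F where "F c = (\<Sum>k\<le>N. (m k c - a k)\<^sup>2)" for c
  define Z :: "'v \<Rightarrow> 'v \<Rightarrow> real" where "Z = (\<lambda>_ _. 0)"
  \<comment> \<open>A kernel with diagonal above \<open>R\<close> misses \<open>a 0\<close> already
    by more than \<open>sqrt (F Z)\<close>, so it is farther from \<open>a\<close> than the zero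
    kernel. The minimum over the compact set is therefore global.\<close>
  define R where "R = max 0 (a 0 + sqrt (F Z))"
  let ?K = "{c. inv_kernel c \<and> c \<rho> \<rho> \<le> R}"
  have Z: "inv_kernel Z" unfolding Z_def by (rule inv_kernel_zero)
  then have "Z \<in> ?K" by (simp add: Z_def R_def)
  moreover have "continuous_on ?K F"
    unfolding F_def m_def by (intro continuous_intros continuous_on_moment)
  ultimately obtain c0 where c0: "inv_kernel c0" and min0: "\<And>c. c \<in> ?K \<Longrightarrow> F c0 \<le> F c"
    using continuous_attains_inf[OF compact_inv_kernels, of \<rho> R F] by blast
  have min: "F c0 \<le> F c" if c: "inv_kernel c" for c
  proof (cases "c \<rho> \<rho> \<le> R")
    case True
    then show ?thesis using c min0 by blast
  next
    case False
    have "F Z \<ge> 0" by (simp add: F_def sum_nonneg)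
    then have "F Z = (sqrt (F Z))\<^sup>2" by simp
    also have "\<dots> \<le> (m 0 c - a 0)\<^sup>2"
      using False \<open>F Z \<ge> 0\<close> by (intro power_mono) (auto simp: R_def m_def)
    also have "\<dots> \<le> F c" unfolding F_def by (rule member_le_sum) auto
    finally show ?thesis using min0[OF \<open>Z \<in> ?K\<close>] by simp
  qed
  define g where "g k = m k c0 - a k" for k
  have F_comb: "F (\<lambda>v w. r * c0 v w + s * c v w) =
      (\<Sum>k\<le>N. (g k + ((r - 1) * m k c0 + s * m k c))\<^sup>2)" for r s c
    unfolding F_def m_def g_def moment_combination by (simp add: algebra_simps)
  have expand: "(\<Sum>k\<le>N. (g k + \<epsilon> * h k)\<^sup>2) = F c0 + 2 * \<epsilon> * (\<Sum>k\<le>N. g k * h k) + \<epsilon>\<^sup>2 * (\<Sum>k\<le>N. (h k)\<^sup>2)"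
    for \<epsilon> h
    by (simp add: F_def g_def[symmetric] power2_sum power_mult_distrib sum.distrib sum_distrib_left mult_ac)
  \<comment> \<open>Kernels form a convex cone, so \<open>c0 + \<epsilon> c\<close> is an admissible
    competitor, and the derivative of \<open>F\<close> at \<open>c0\<close> in the direction
    \<open>c\<close> is nonnegative.\<close>
  have pos: "0 \<le> (\<Sum>k\<le>N. g k * m k c)" if c: "inv_kernel c" for c
  proof (rule first_order_nonneg)
    fix \<epsilon> :: real assume "0 < \<epsilon>"
    then have "F c0 \<le> F (\<lambda>v w. 1 * c0 v w + \<epsilon> * c v w)"
      by (intro min inv_kernel_combination c0 c) auto
    also have "\<dots> = F c0 + 2 * \<epsilon> * (\<Sum>k\<le>N. g k * m k c) + \<epsilon>\<^sup>2 * (\<Sum>k\<le>N. (m k c)\<^sup>2)"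
      unfolding F_comb using expand[of \<epsilon> "\<lambda>k. m k c"] by simp
    finally show "0 \<le> 2 * \<epsilon> * (\<Sum>k\<le>N. g k * m k c) + \<epsilon>\<^sup>2 * (\<Sum>k\<le>N. (m k c)\<^sup>2)" by simp
  qed
  \<comment> \<open>Shrinking \<open>c0\<close> towards 0 is admissible too, which tests the
    direction \<open>- c0\<close>.\<close>
  have "0 \<le> - (\<Sum>k\<le>N. g k * m k c0)"
  proof (rule first_order_nonneg)
    fix \<epsilon> :: real assume "0 < \<epsilon>" "\<epsilon> \<le> 1"
    then have "F c0 \<le> F (\<lambda>v w. (1 - \<epsilon>) * c0 v w + 0 * c0 v w)"
      by (intro min inv_kernel_combination c0) auto
    also have "\<dots> = F c0 + 2 * \<epsilon> * - (\<Sum>k\<le>N. g k * m k c0) + \<epsilon>\<^sup>2 * (\<Sum>k\<le>N. (m k c0)\<^sup>2)"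
      unfolding F_comb using expand[of "\<epsilon>" "\<lambda>k. - m k c0"] by (simp add: sum_negf)
    finally show "0 \<le> 2 * \<epsilon> * - (\<Sum>k\<le>N. g k * m k c0) + \<epsilon>\<^sup>2 * (\<Sum>k\<le>N. (m k c0)\<^sup>2)" by simp
  qed
  \<comment> \<open>The separating polynomial has the residuals \<open>g\<close> as coefficients;
    \<open>pos\<close> says that it is accretive.\<close>
  moreover have "0 \<le> (\<Sum>k\<le>N. g k * a k)"
  proof -
    define p where "p = (\<Sum>k\<le>N. monom (g k) k)"
    have coeff_p: "coeff p k = (if k \<le> N then g k else 0)" for k
      by (simp add: p_def coeff_sum)
    have deg: "degree p \<le> N" by (rule degree_le) (simp add: coeff_p)
    have "accretive \<rho> p"
      using pos by (simp add: accretive_def adj_poly_eq_sum[OF deg] coeff_p m_def)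
    then have "0 \<le> (\<Sum>k\<le>degree p. coeff p k * a k)" by (rule sep)
    also have "\<dots> = (\<Sum>k\<le>N. coeff p k * a k)"
      using deg by (intro sum.mono_neutral_left) (auto simp: coeff_eq_0)
    finally show ?thesis by (simp add: coeff_p)
  qed
  \<comment> \<open>Here the first sum on the right is at most 0 and the second at least 0, which
    forces all residuals to vanish.\<close>
  moreover have "(\<Sum>k\<le>N. (g k)\<^sup>2) = (\<Sum>k\<le>N. g k * m k c0) - (\<Sum>k\<le>N. g k * a k)"
    by (simp add: g_def power2_eq_square right_diff_distrib flip: sum_subtractf)
  ultimately have "(\<Sum>k\<le>N. (g k)\<^sup>2) \<le> 0" by simp
  then have "(\<Sum>k\<le>N. (g k)\<^sup>2) = 0" by (simp add: antisym sum_nonneg)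
  then have "\<forall>k\<le>N. g k = 0" by (simp add: sum_nonneg_eq_0_iff)
  then show ?thesis using c0 by (auto simp: g_def m_def)
qed

text \<open>Finite intersection property. The zeroth moment is \<open>c \<rho> \<rho>\<close>, so
  all the approximating kernels lie in one compact set with diagonal bound
  \<open>a 0\<close>.\<close>

lemma ex_inv_kernel_moments:
  fixes a :: "nat \<Rightarrow> real"
  assumes fin: "\<And>N. \<exists>c. inv_kernel c \<and> (\<forall>k\<le>N. adj_pow E k (\<lambda>w. c w \<rho>) \<rho> = a k)"
  shows "\<exists>c. inv_kernel c \<and> (\<forall>k. adj_pow E k (\<lambda>w. c w \<rho>) \<rho> = a k)"
proof -
  let ?K = "{c. inv_kernel c \<and> c \<rho> \<rho> \<le> a 0}"
  let ?T = "\<lambda>k. {c. adj_pow E k (\<lambda>w. c w \<rho>) \<rho> = a k}"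
  have "?K \<inter> (\<Inter>k\<in>UNIV. ?T k) \<noteq> {}"
  proof (rule compact_imp_fip_image[OF compact_inv_kernels])
    show "closed (?T k)" for k
      by (intro closed_Collect_eq continuous_on_moment continuous_intros)
    fix I :: "nat set" assume "finite I"
    then obtain N where N: "\<forall>k\<in>I. k \<le> N" using finite_nat_set_iff_bounded_le by blast
    obtain c where c: "inv_kernel c" "\<forall>k\<le>N. adj_pow E k (\<lambda>w. c w \<rho>) \<rho> = a k" using fin by blast
    then have "c \<rho> \<rho> = a 0" by (metis adj_pow.simps(1) le0)
    then have "c \<in> ?K \<inter> (\<Inter>k\<in>I. ?T k)" using c N by auto
    then show "?K \<inter> (\<Inter>k\<in>I. ?T k) \<noteq> {}" by blast
  qed
  then show ?thesis by blast
qed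

text \<open>The Gaussian law with covariance \<open>c\<close> serves: it is determined by
  \<open>c\<close>, so it inherits the invariance.\<close>

lemma ex_invariant_process_inv_kernel:
  assumes c: "inv_kernel c"
  shows "\<exists>P. invariant_process E P \<and> (\<forall>v w. integrable P (\<lambda>x. x v * x w) \<and> (LINT x|P. x v * x w) = c v w)"
proof -
  have psd: "psd_kernel c" using c by (simp add: inv_kernel_def)
  obtain P where P: "gaussian_on UNIV c P" using ex_gaussian_on_UNIV[OF psd] ..
  have "invariant_process E P"
    unfolding invariant_process_def
  proof (intro conjI allI impI)
    show "prob_space P" "sets P = sets config_space" using P by (simp_all add: gaussian_on_def)
    fix \<gamma> assume \<gamma>: "graph_automorphism E \<gamma>"
    show "distr P config_space (\<lambda>x. x \<circ> \<gamma>) = P"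
    proof (rule gaussian_on_invariant[OF P])
      show "bij \<gamma>" using \<gamma> by (simp add: graph_automorphism_def)
      show "c (\<gamma> v) (\<gamma> w) = c v w" for v w using c \<gamma> unfolding inv_kernel_def by blast
    qed
  qed
  then show ?thesis using gaussian_on_covariance[OF psd P] by blast
qed

end

theorem theorem3:
  fixes E :: "'v \<Rightarrow> 'v \<Rightarrow> bool" and d :: nat and \<rho> :: 'v and \<mu> :: "real measure"
  assumes "infinite (UNIV :: 'v set)"
    and "regular_graph E d"
    and "vertex_transitive E"
    and "sets \<mu> = sets borel" and "finite_measure \<mu>"
    and "measure_support \<mu> \<subseteq> process_spectrum E d \<rho>"
  shows "\<exists>P. invariant_process E P \<and> integrable P (\<lambda>x. (x \<rho>)\<^sup>2)
             \<and> spectral_measure_of E d \<rho> P \<mu>"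
proof -
  interpret transitive_graph E d by unfold_locales fact+
  interpret \<mu>: finite_measure \<mu> by fact
  have [measurable_cong]: "sets \<mu> = sets borel" by fact
  have AE_psp: "AE t in \<mu>. t \<in> process_spectrum E d \<rho>"
    using AE_measure_support[OF assms(4)] assms(6) by auto
  have AE_bd: "AE t in \<mu>. t \<in> {- real d..real d}"
    using AE_psp by eventually_elim (use process_spectrum_bounded in blast)
  have int: "integrable \<mu> (\<lambda>t. t ^ k)" for k
  proof (rule \<mu>.integrable_const_bound)
    show "AE t in \<mu>. norm (t ^ k) \<le> real d ^ k"
      using AE_bd by eventually_elim (auto simp: power_abs intro!: power_mono)
  qed measurable
  define a where "a k = (LINT t|\<mu>. t ^ k)" for k
  \<comment> \<open>The pairing of \<open>p\<close> with the moments is the integral of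
    \<open>p\<close>, which is nonnegative because \<open>\<mu>\<close> is concentrated on its
    support, hence on the process spectrum.\<close>
  have "0 \<le> (\<Sum>k\<le>degree p. coeff p k * a k)"
    if p: "accretive \<rho> p" for p
  proof -
    have "AE t in \<mu>. 0 \<le> poly p t"
      using AE_psp by eventually_elim (rule poly_nonneg_on_process_spectrum[OF p])
    then have "0 \<le> (LINT t|\<mu>. poly p t)" by (rule integral_nonneg_AE)
    then show ?thesis
      using int by (simp add: poly_altdef a_def Bochner_Integration.integral_sum)
  qed
  then obtain c where c: "inv_kernel c" "\<And>k. adj_pow E k (\<lambda>w. c w \<rho>) \<rho> = a k"
    using ex_inv_kernel_moments[OF ex_inv_kernel_finite_moments] by metis
  obtain P where P: "invariant_process E P" "\<And>v w. integrable P (\<lambda>x. x v * x w)"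
      "\<And>v w. (LINT x|P. x v * x w) = c v w"
    using ex_invariant_process_inv_kernel[OF c(1)] by blast
  have "- {- real d..real d} \<in> null_sets \<mu>"
    using AE_bd by (subst AE_iff_null_sets) auto
  then have "spectral_measure_of E d \<rho> P \<mu>"
    using assms(4,5) int integral_adj_pow[OF P(2)] c(2)
    by (auto simp: spectral_measure_of_def P(3) a_def)
  then show ?thesis
    using P(1) P(2)[of \<rho> \<rho>] by (auto simp: power2_eq_square)
qed

end
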